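(* Let $F$ be a finitely generated free group of rank at least $2$ and let $\hat F=\varprojlim F/\gamma_i(F)$ be its pronilpotent completion. Then $\hat F$ is a filtered union of its countable parafree subgroups; that is, the set of countable parafree subgroups of $\hat F$ is directed by inclusion and its union is $\hat F$.
   Context: $\gamma_i(G)$ denotes the lower central series of a group $G$ ($\gamma_1(G)=G$). The free group $F$ is residually nilpotent and is regarded as a subgroup of $\hat F$ via the canonical map. A subgroup $G$ of $\hat F$ is called a parafree subgroup of $\hat F$ if $F\subseteq G\subseteq\hat F$ and the embedding $F\subseteq G$ induces isomorphisms $F/\gamma_i(F)\cong G/\gamma_i(G)$ for all $i\ge1$. *)

theory Defs
  imports "HOL-Algebra.Product_Groups" "HOL-Library.Countable_Set"
begin

section \<open>Free groups\<close>

text \<open>A letter \<open>(x, True)\<close> stands for the generator \<open>x\<close> and \<open>(x, False)\<close> for its formal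
  inverse.  The free group on \<open>B\<close> consists of the reduced words over \<open>B\<close>; two words are
  multiplied by concatenating them and cancelling.\<close>

definition inv_letter :: "'x \<times> bool \<Rightarrow> 'x \<times> bool"
  where "inv_letter l = (fst l, \<not> snd l)"

fun reduced :: "('x \<times> bool) list \<Rightarrow> bool" where
  "reduced [] = True"
| "reduced [l] = True"
| "reduced (l # m # w) = (m \<noteq> inv_letter l \<and> reduced (m # w))"

fun push_letter :: "'x \<times> bool \<Rightarrow> ('x \<times> bool) list \<Rightarrow> ('x \<times> bool) list" where
  "push_letter l [] = [l]"
| "push_letter l (m # w) = (if m = inv_letter l then w else l # m # w)"

definition free_group :: "'x set \<Rightarrow> ('x \<times> bool) list monoid"
  where "free_group B =
    \<lparr>carrier = {w. reduced w \<and> fst ` set w \<subseteq> B},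
     monoid.mult = foldr push_letter,
     one = []\<rparr>"

lemma free_group_simps:
  "w \<in> carrier (free_group B) \<longleftrightarrow> reduced w \<and> fst ` set w \<subseteq> B"
  "u \<otimes>\<^bsub>free_group B\<^esub> v = foldr push_letter u v"
  "\<one>\<^bsub>free_group B\<^esub> = []"
  by (simp_all add: free_group_def)

lemma inv_letter_inv_letter [simp]: "inv_letter (inv_letter l) = l"
  by (simp add: inv_letter_def)

lemma fst_inv_letter [simp]: "fst (inv_letter l) = fst l"
  by (simp add: inv_letter_def)

lemma inv_letter_neq [simp]: "inv_letter l \<noteq> l" "l \<noteq> inv_letter l"
  by (auto simp: inv_letter_def prod_eq_iff)

lemma reduced_tl: "reduced (l # w) \<Longrightarrow> reduced w"
  by (cases w) auto

lemma reduced_push: "reduced w \<Longrightarrow> reduced (push_letter l w)"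
  by (cases w) (auto dest: reduced_tl)

lemma push_push: "reduced w \<Longrightarrow> push_letter l (push_letter (inv_letter l) w) = w"
proof (cases w)
  case (Cons m v)
  assume "reduced w"
  with Cons show ?thesis by (cases v) auto
qed simp

lemma reduced_foldr_push: "reduced v \<Longrightarrow> reduced (foldr push_letter u v)"
  by (induction u) (auto intro: reduced_push)

lemma set_push: "set (push_letter l w) \<subseteq> insert l (set w)"
  by (cases w) auto

lemma set_foldr_push:
  assumes "fst ` set u \<subseteq> B" "fst ` set v \<subseteq> B"
  shows "fst ` set (foldr push_letter u v) \<subseteq> B"
  using assms
proof (induction u)
  case (Cons l u)
  then have "fst ` insert l (set (foldr push_letter u v)) \<subseteq> B" by simp
  then show ?case using set_push[of l "foldr push_letter u v"] by (simp) blast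
qed simp

lemma push_reduced: "reduced (l # w) \<Longrightarrow> push_letter l w = l # w"
  by (cases w) auto

lemma foldr_push_Nil: "reduced u \<Longrightarrow> foldr push_letter u [] = u"
proof (induction u)
  case (Cons l u)
  then show ?case using reduced_tl[of l u] push_reduced[of l u] by simp
qed simp

lemma foldr_push_push:
  assumes "reduced w"
  shows "foldr push_letter (push_letter l v) w = push_letter l (foldr push_letter v w)"
  using push_push[OF reduced_foldr_push[OF assms], of l] by (cases v) auto

lemma foldr_push_assoc:
  assumes "reduced w"
  shows "foldr push_letter (foldr push_letter u v) w = foldr push_letter u (foldr push_letter v w)"
  by (induction u) (auto simp: foldr_push_push[OF assms])

lemma foldr_push_inverse:
  assumes "reduced w"
  shows "foldr push_letter (map inv_letter (rev u)) (foldr push_letter u w) = w"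
proof (induction u)
  case (Cons l u)
  have "push_letter (inv_letter l) (push_letter l (foldr push_letter u w)) = foldr push_letter u w"
    using push_push[OF reduced_foldr_push[OF assms], of "inv_letter l"] by simp
  then show ?case using Cons by simp
qed (use assms in simp)

lemma group_free_group: "group (free_group B)"
proof (rule groupI)
  fix u v w
  assume uvw: "u \<in> carrier (free_group B)" "v \<in> carrier (free_group B)" "w \<in> carrier (free_group B)"
  show "u \<otimes>\<^bsub>free_group B\<^esub> v \<otimes>\<^bsub>free_group B\<^esub> w = u \<otimes>\<^bsub>free_group B\<^esub> (v \<otimes>\<^bsub>free_group B\<^esub> w)"
    using uvw by (simp add: free_group_simps foldr_push_assoc)
next
  fix u v
  assume "u \<in> carrier (free_group B)" "v \<in> carrier (free_group B)"
  then show "u \<otimes>\<^bsub>free_group B\<^esub> v \<in> carrier (free_group B)"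
    by (simp add: free_group_simps reduced_foldr_push set_foldr_push)
next
  fix u
  assume u: "u \<in> carrier (free_group B)"
  define v where "v = foldr push_letter (map inv_letter (rev u)) []"
  have "v \<in> carrier (free_group B)"
    using u set_foldr_push[of "map inv_letter (rev u)" B "[]"]
    by (simp add: free_group_simps v_def reduced_foldr_push image_image)
  moreover have "v \<otimes>\<^bsub>free_group B\<^esub> u = \<one>\<^bsub>free_group B\<^esub>"
    using u foldr_push_inverse[of "[]" u]
    by (simp add: free_group_simps v_def foldr_push_assoc foldr_push_Nil)
  ultimately show "\<exists>v\<in>carrier (free_group B). v \<otimes>\<^bsub>free_group B\<^esub> u = \<one>\<^bsub>free_group B\<^esub>"
    by blast
qed (auto simp: free_group_simps)

lemma free_group_universal:
  assumes H: "group H" and f: "f \<in> B \<rightarrow> carrier H"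
  shows "\<exists>h \<in> hom (free_group B) H. \<forall>x\<in>B. h [(x, True)] = f x"
    and "\<lbrakk>h \<in> hom (free_group B) H; h' \<in> hom (free_group B) H; \<forall>x\<in>B. h [(x, True)] = h' [(x, True)];
          w \<in> carrier (free_group B)\<rbrakk> \<Longrightarrow> h w = h' w"
proof -
  interpret H: group H by (rule H)
  define e where "e l = (if snd l then f (fst l) else inv\<^bsub>H\<^esub> (f (fst l)))" for l
  define g where "g w = foldr (\<lambda>l r. e l \<otimes>\<^bsub>H\<^esub> r) w \<one>\<^bsub>H\<^esub>" for w
  have e: "e l \<in> carrier H" if "fst l \<in> B" for l
    using that f by (auto simp: e_def)
  have ee: "e l \<otimes>\<^bsub>H\<^esub> e (inv_letter l) = \<one>\<^bsub>H\<^esub>" if "fst l \<in> B" for l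
    using funcset_mem[OF f that] by (simp add: e_def inv_letter_def)
  have gC: "g (l # w) = e l \<otimes>\<^bsub>H\<^esub> g w" for l w by (simp add: g_def)
  have g: "g w \<in> carrier H" if "fst ` set w \<subseteq> B" for w
    using that by (induction w) (auto simp: g_def e)
  have gp: "g (push_letter l w) = e l \<otimes>\<^bsub>H\<^esub> g w" if "fst l \<in> B" "fst ` set w \<subseteq> B" for l w
  proof (cases w)
    case (Cons m v)
    have "e l \<otimes>\<^bsub>H\<^esub> (e (inv_letter l) \<otimes>\<^bsub>H\<^esub> g v) = g v"
      using that Cons g[of v] e[of l] e[of "inv_letter l"] ee[of l]
      by (simp add: H.m_assoc[symmetric])
    then show ?thesis using Cons by (simp add: gC)
  qed (simp add: gC)
  have gm: "g (foldr push_letter u v) = g u \<otimes>\<^bsub>H\<^esub> g v"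
    if "fst ` set u \<subseteq> B" "fst ` set v \<subseteq> B" for u v
    using that
  proof (induction u)
    case (Cons l u)
    have "fst ` set (foldr push_letter u v) \<subseteq> B"
      using Cons.prems set_foldr_push[of u B v] by simp
    then show ?case using Cons by (simp add: gp gC g e H.m_assoc)
  qed (simp add: g, simp add: g_def g[unfolded g_def])
  have "g \<in> hom (free_group B) H"
    by (rule homI) (auto simp: free_group_simps g gm)
  moreover have "\<forall>x\<in>B. g [(x, True)] = f x"
    using funcset_mem[OF f] by (simp add: g_def e_def)
  ultimately show "\<exists>h \<in> hom (free_group B) H. \<forall>x\<in>B. h [(x, True)] = f x" by blast
next
  assume hh: "h \<in> hom (free_group B) H" "h' \<in> hom (free_group B) H"
    and eq: "\<forall>x\<in>B. h [(x, True)] = h' [(x, True)]"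
  interpret H: group H by (rule H)
  interpret F: group "free_group B" by (rule group_free_group)
  interpret h: group_hom "free_group B" H h by unfold_locales (rule hh)
  interpret h': group_hom "free_group B" H h' by unfold_locales (rule hh)
  have letter: "h [l] = h' [l]" if "fst l \<in> B" for l
  proof (cases "snd l")
    case True
    then have "l = (fst l, True)" by (metis prod.collapse)
    then show ?thesis using eq that by metis
  next
    case False
    then have l: "l = (fst l, False)" by (metis prod.collapse)
    have c: "[l] \<in> carrier (free_group B)" "[(fst l, True)] \<in> carrier (free_group B)"
      using that by (auto simp: free_group_simps)
    have "[l] \<otimes>\<^bsub>free_group B\<^esub> [(fst l, True)] = \<one>\<^bsub>free_group B\<^esub>"
      by (subst l) (simp add: free_group_simps inv_letter_def)
    then have "[l] = inv\<^bsub>free_group B\<^esub> [(fst l, True)]"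
      using c F.inv_equality by metis
    then show ?thesis using eq that c by (metis h.hom_inv h'.hom_inv)
  qed
  show "h w = h' w" if "w \<in> carrier (free_group B)"
    using that
  proof (induction w)
    case Nil
    then show ?case using h.hom_one h'.hom_one by (simp add: free_group_simps)
  next
    case (Cons l w)
    have c: "[l] \<in> carrier (free_group B)" "w \<in> carrier (free_group B)"
      using Cons.prems by (auto simp: free_group_simps dest: reduced_tl)
    have "l # w = [l] \<otimes>\<^bsub>free_group B\<^esub> w"
      using Cons.prems by (simp add: free_group_simps push_reduced)
    then show ?case using c Cons letter[of l] by (simp add: free_group_simps(1))
  qed
qed

section \<open>Lower central series and pronilpotent completion\<close>

definition commutator_subgroup :: "('a, 'm) monoid_scheme \<Rightarrow> 'a set \<Rightarrow> 'a set \<Rightarrow> 'a set"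
  where "commutator_subgroup G H K =
    generate G {h \<otimes>\<^bsub>G\<^esub> k \<otimes>\<^bsub>G\<^esub> inv\<^bsub>G\<^esub> h \<otimes>\<^bsub>G\<^esub> inv\<^bsub>G\<^esub> k | h k. h \<in> H \<and> k \<in> K}"

text \<open>The series is indexed from \<open>1\<close>; the value at \<open>0\<close> is a dummy.\<close>

fun lower_central :: "('a, 'm) monoid_scheme \<Rightarrow> nat \<Rightarrow> 'a set" where
  "lower_central G 0 = carrier G"
| "lower_central G (Suc 0) = carrier G"
| "lower_central G (Suc (Suc i)) = commutator_subgroup G (lower_central G (Suc i)) (carrier G)"

text \<open>For a homomorphism \<open>h\<close> from \<open>G\<close> to \<open>H\<close> mapping \<open>N\<close> into \<open>M\<close>, the map
  \<open>quotient_map H M h\<close> is the induced homomorphism from \<open>G Mod N\<close> to \<open>H Mod M\<close>: it sends the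
  coset \<open>C = N #> x\<close> to the unique element \<open>M #> h x\<close> of the image of \<open>C\<close> in \<open>H Mod M\<close>.\<close>

definition quotient_map ::
  "('b, 'm) monoid_scheme \<Rightarrow> 'b set \<Rightarrow> ('a \<Rightarrow> 'b) \<Rightarrow> 'a set \<Rightarrow> 'b set"
  where "quotient_map H M h C = the_elem ((\<lambda>x. M #>\<^bsub>H\<^esub> h x) ` C)"

definition pronilpotent_completion :: "('a, 'm) monoid_scheme \<Rightarrow> (nat \<Rightarrow> 'a set) monoid"
  where "pronilpotent_completion F =
    (let P = product_group {1..} (\<lambda>i. F Mod lower_central F i)
     in P\<lparr>carrier := {s \<in> carrier P. \<forall>i j. 1 \<le> i \<and> i \<le> j \<longrightarrow>
                        quotient_map F (lower_central F i) (\<lambda>x. x) (s j) = s i}\<rparr>)"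

definition completion_map :: "('a, 'm) monoid_scheme \<Rightarrow> 'a \<Rightarrow> nat \<Rightarrow> 'a set"
  where "completion_map F x = (\<lambda>i\<in>{1..}. lower_central F i #>\<^bsub>F\<^esub> x)"

section \<open>Parafree subgroups of the completion\<close>

text \<open>\<open>F\<close> is identified with its image under \<open>completion_map F\<close> (which is injective when \<open>F\<close> is
  residually nilpotent), so the embedding of \<open>F\<close> into \<open>G\<close> is \<open>completion_map F\<close> itself.\<close>

definition parafree_subgroup :: "('a, 'm) monoid_scheme \<Rightarrow> (nat \<Rightarrow> 'a set) set \<Rightarrow> bool"
  where "parafree_subgroup F G \<longleftrightarrow>
    subgroup G (pronilpotent_completion F) \<and>
    completion_map F ` carrier F \<subseteq> G \<and>
    (let G' = (pronilpotent_completion F)\<lparr>carrier := G\<rparr>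
     in \<forall>i\<ge>1. quotient_map G' (lower_central G' i) (completion_map F)
                 \<in> iso (F Mod lower_central F i) (G' Mod lower_central G' i))"

definition countable_parafree_subgroups :: "('a, 'm) monoid_scheme \<Rightarrow> (nat \<Rightarrow> 'a set) set set"
  where "countable_parafree_subgroups F = {G. parafree_subgroup F G \<and> countable G}"

end

theory Submission
  imports Defs "HOL-Algebra.Zassenhaus"
begin

text \<open>
  Write \<open>P\<close> for the completion of \<open>F\<close> and \<open>c\<close> for the canonical map from \<open>F\<close> to \<open>P\<close>.  The proof
  rests on two facts about commutators, followed by a closing-off argument.  The free
  generators of \<open>F\<close> are \<open>x\<^sub>1, \<dots>, x\<^sub>n\<close>.

  The first fact, \<open>completion_commutator_product\<close>, is that every element of \<open>P\<close> can be written as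
  \<open>[y\<^sub>1, c x\<^sub>1] \<dots> [y\<^sub>n, c x\<^sub>n] \<cdot> c f\<close> with \<open>y\<^sub>1, \<dots>, y\<^sub>n\<close> in \<open>P\<close> and \<open>f\<close> in \<open>F\<close>.  The \<open>y\<^sub>j\<close> are
  limits of successive approximations in \<open>F\<close>.  If the product agrees with the target modulo
  \<open>\<gamma>\<^sub>k\<^sub>+\<^sub>2\<close>, the error lies in \<open>\<gamma>\<^sub>k\<^sub>+\<^sub>2 = [\<gamma>\<^sub>k\<^sub>+\<^sub>1, F]\<close>.  Modulo \<open>\<gamma>\<^sub>k\<^sub>+\<^sub>3\<close> the commutator is bimultiplicative
  on \<open>\<gamma>\<^sub>k\<^sub>+\<^sub>1 \<times> F\<close> with central values, so the error is a product of \<open>[z\<^sub>j, x\<^sub>j]\<close> with \<open>z\<^sub>j\<close> in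
  \<open>\<gamma>\<^sub>k\<^sub>+\<^sub>1\<close>, and replacing \<open>y\<^sub>j\<close> by \<open>y\<^sub>j z\<^sub>j\<close> removes it.  As \<open>y\<^sub>j\<close> changes only within its coset of
  \<open>\<gamma>\<^sub>k\<^sub>+\<^sub>1\<close>, the approximations form an element of \<open>P\<close>.

  The second fact, \<open>parafree_subgroupI\<close>, is that a subgroup \<open>S\<close> of \<open>P\<close> that contains \<open>c(F)\<close> is
  parafree as soon as \<open>S = \<gamma>\<^sub>2(S) c(F)\<close>.  Surjectivity of \<open>F/\<gamma>\<^sub>i(F) \<rightarrow> S/\<gamma>\<^sub>i(S)\<close> for all \<open>i\<close> follows from
  the case \<open>i = 2\<close>, because a subgroup that covers the abelianisation covers every nilpotent quotient
  (\<open>lower_central_set_mult_eq_carrier\<close>).  Injectivity is automatic: the \<open>i\<close>-th coordinate of an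
  element of \<open>\<gamma>\<^sub>i(S)\<close> lies in \<open>\<gamma>\<^sub>i(F/\<gamma>\<^sub>i(F))\<close>, which is trivial.

  Consequently, any countable subset of \<open>P\<close> can be enlarged to a countable parafree subgroup: add
  \<open>c(F)\<close>, and then close under the group operations and under passing from an element to its
  finitely many \<open>y\<^sub>j\<close>.  Starting from the empty set, from a single element and from the union of two
  countable parafree subgroups gives the three claims.
\<close>

section \<open>Commutators and cosets\<close>

definition commutator :: "('a, 'm) monoid_scheme \<Rightarrow> 'a \<Rightarrow> 'a \<Rightarrow> 'a" where
  "commutator G x y = x \<otimes>\<^bsub>G\<^esub> y \<otimes>\<^bsub>G\<^esub> inv\<^bsub>G\<^esub> x \<otimes>\<^bsub>G\<^esub> inv\<^bsub>G\<^esub> y"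

lemma commutator_subgroup_eq:
  "commutator_subgroup G H K = generate G {commutator G h k | h k. h \<in> H \<and> k \<in> K}"
  by (simp add: commutator_subgroup_def commutator_def)

lemma (in group) commutator_closed [simp]:
  "x \<in> carrier G \<Longrightarrow> y \<in> carrier G \<Longrightarrow> commutator G x y \<in> carrier G"
  by (simp add: commutator_def)

lemma (in group) inv_cancel_left:
  assumes "x \<in> carrier G" "y \<in> carrier G"
  shows "inv x \<otimes> (x \<otimes> y) = y" "x \<otimes> (inv x \<otimes> y) = y"
  using assms by (simp_all flip: m_assoc)

lemma (in group) commutator_mult_left:
  assumes "y \<in> carrier G" "h \<in> carrier G" "g \<in> carrier G"
  shows "commutator G (y \<otimes> h) g = y \<otimes> commutator G h g \<otimes> inv y \<otimes> commutator G y g"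
  using assms by (simp add: commutator_def m_assoc inv_mult_group inv_cancel_left)

lemma (in group) commutator_mult_right:
  assumes "h \<in> carrier G" "g \<in> carrier G" "k \<in> carrier G"
  shows "commutator G h (g \<otimes> k) = commutator G h g \<otimes> (g \<otimes> commutator G h k \<otimes> inv g)"
  using assms by (simp add: commutator_def m_assoc inv_mult_group inv_cancel_left)

lemma (in group) conj_commutator:
  assumes "x \<in> carrier G" "y \<in> carrier G" "g \<in> carrier G"
  shows "g \<otimes> commutator G x y \<otimes> inv g =
    commutator G (g \<otimes> x \<otimes> inv g) (g \<otimes> y \<otimes> inv g)"
  using assms by (simp add: commutator_def m_assoc inv_mult_group inv_cancel_left)

lemma (in group) commutator_eq_one_iff:
  assumes "x \<in> carrier G" "y \<in> carrier G"
  shows "commutator G x y = \<one> \<longleftrightarrow> x \<otimes> y = y \<otimes> x"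
proof -
  have "commutator G x y = (x \<otimes> y) \<otimes> inv (y \<otimes> x)"
    using assms by (simp add: commutator_def m_assoc inv_mult_group)
  then show ?thesis using assms by (simp add: inv_solve_right')
qed

lemma (in group) commutator_one [simp]:
  assumes "x \<in> carrier G"
  shows "commutator G x \<one> = \<one>" "commutator G \<one> x = \<one>"
  using assms by (simp_all add: commutator_eq_one_iff)

lemma (in group_hom) hom_commutator:
  assumes "x \<in> carrier G" "y \<in> carrier G"
  shows "h (commutator G x y) = commutator H (h x) (h y)"
  using assms by (simp add: commutator_def)

lemma commutator_consistent:
  assumes "group G" "subgroup S G" "x \<in> S" "y \<in> S"
  shows "commutator (G\<lparr>carrier := S\<rparr>) x y = commutator G x y"
  using assms by (simp add: commutator_def group.m_inv_consistent)

lemma (in normal) coset_group_hom: "group_hom G (G Mod H) (\<lambda>x. H #> x)"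
  by (simp add: group_hom_axioms_def group_hom_def factorgroup_is_group is_group r_coset_hom_Mod)

lemma (in normal) coset_eq_iff:
  assumes "x \<in> carrier G" "y \<in> carrier G"
  shows "H #> x = H #> y \<longleftrightarrow> x \<otimes> inv y \<in> H"
proof
  assume "H #> x = H #> y"
  then have "x \<in> H #> y" using assms rcos_self[OF assms(1) subgroup_axioms] by simp
  then show "x \<otimes> inv y \<in> H"
    using assms by (metis rcos_module_imp is_group)
next
  assume "x \<otimes> inv y \<in> H"
  then have "x \<in> H #> y"
    using assms by (metis rcos_module_rev is_group)
  then show "H #> x = H #> y"
    using assms repr_independence subgroup_axioms by blast
qed

lemma (in normal) coset_eq_self_iff:
  assumes "x \<in> carrier G"
  shows "H #> x = H \<longleftrightarrow> x \<in> H"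
  using coset_eq_iff[OF assms one_closed] assms subset by simp

lemma coset_eq_mono:
  assumes N: "N \<lhd> G" and M: "M \<lhd> G" and "N \<subseteq> M" and xy: "x \<in> carrier G" "y \<in> carrier G"
    and eq: "N #>\<^bsub>G\<^esub> x = N #>\<^bsub>G\<^esub> y"
  shows "M #>\<^bsub>G\<^esub> x = M #>\<^bsub>G\<^esub> y"
proof -
  have "x \<otimes>\<^bsub>G\<^esub> inv\<^bsub>G\<^esub> y \<in> N" using eq normal.coset_eq_iff[OF N xy] by simp
  then show ?thesis using \<open>N \<subseteq> M\<close> by (simp add: normal.coset_eq_iff[OF M xy] subsetD)
qed

text \<open>The value of \<open>quotient_map\<close> is read off from one representative because
  \<open>x \<mapsto> M #> h x\<close> is constant on every coset of \<open>N\<close>.\<close>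

lemma quotient_map_coset:
  assumes N: "N \<lhd> G" and M: "M \<lhd> H" and h: "h \<in> hom G H" and NM: "h ` N \<subseteq> M"
    and x: "x \<in> carrier G"
  shows "quotient_map H M h (N #>\<^bsub>G\<^esub> x) = M #>\<^bsub>H\<^esub> h x"
proof -
  interpret N: normal N G by fact
  interpret M: normal M H by fact
  interpret group_hom G H h by unfold_locales (fact h)
  have "M #>\<^bsub>H\<^esub> h y = M #>\<^bsub>H\<^esub> h x" if "y \<in> N #>\<^bsub>G\<^esub> x" for y
  proof -
    from that obtain n where n: "n \<in> N" "y = n \<otimes>\<^bsub>G\<^esub> x" by (auto simp: r_coset_def)
    have "h n \<in> M" using n NM by auto
    then show ?thesis
      using n x by (subst M.coset_eq_iff) (auto simp: M.m_assoc)
  qed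
  then have "(\<lambda>y. M #>\<^bsub>H\<^esub> h y) ` (N #>\<^bsub>G\<^esub> x) = (\<lambda>_. M #>\<^bsub>H\<^esub> h x) ` (N #>\<^bsub>G\<^esub> x)"
    by (rule image_cong[OF refl])
  moreover have "x \<in> N #>\<^bsub>G\<^esub> x" by (rule N.rcos_self[OF x N.subgroup_axioms])
  ultimately have "(\<lambda>y. M #>\<^bsub>H\<^esub> h y) ` (N #>\<^bsub>G\<^esub> x) = {M #>\<^bsub>H\<^esub> h x}" by auto
  then show ?thesis by (simp add: quotient_map_def)
qed

section \<open>The lower central series\<close>

lemma lower_central_Suc:
  "i \<ge> 1 \<Longrightarrow> lower_central G (Suc i) = commutator_subgroup G (lower_central G i) (carrier G)"
  by (cases i) auto

declare lower_central.simps(3) [simp del]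

lemma (in group) commutator_subgroup_normal:
  assumes "N \<lhd> G" shows "commutator_subgroup G N (carrier G) \<lhd> G"
  unfolding commutator_subgroup_eq
proof (rule normal_generateI)
  interpret N: normal N G by fact
  show "{commutator G h k | h k. h \<in> N \<and> k \<in> carrier G} \<subseteq> carrier G" by auto
  fix c g assume "c \<in> {commutator G h k | h k. h \<in> N \<and> k \<in> carrier G}" and g: "g \<in> carrier G"
  then obtain h k where "c = commutator G h k" "h \<in> N" "k \<in> carrier G" by auto
  then have "g \<otimes> c \<otimes> inv g = commutator G (g \<otimes> h \<otimes> inv g) (g \<otimes> k \<otimes> inv g)"
    and "g \<otimes> h \<otimes> inv g \<in> N" "g \<otimes> k \<otimes> inv g \<in> carrier G"
    using g by (simp_all add: conj_commutator N.inv_op_closed2)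
  then show "g \<otimes> c \<otimes> inv g \<in> {commutator G h k | h k. h \<in> N \<and> k \<in> carrier G}" by blast
qed

lemma (in group) lower_central_normal: "lower_central G i \<lhd> G"
proof (cases i)
  case (Suc j)
  have "lower_central G (Suc j) \<lhd> G" for j
    by (induction j) (auto simp: lower_central_Suc intro: commutator_subgroup_normal normal_self)
  then show ?thesis using Suc by simp
qed (simp add: normal_self)

lemma (in group) commutator_in_lower_central:
  assumes "i \<ge> 1" "h \<in> lower_central G i" "g \<in> carrier G"
  shows "commutator G h g \<in> lower_central G (Suc i)"
  using assms by (auto simp: lower_central_Suc commutator_subgroup_eq intro!: generate.incl)

lemma (in group) lower_central_Suc_subset: "lower_central G (Suc i) \<subseteq> lower_central G i"
proof (cases "i = 0")
  case False
  interpret N: normal "lower_central G i" G by (rule lower_central_normal)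
  have "commutator G h k \<in> lower_central G i"
    if h: "h \<in> lower_central G i" and k: "k \<in> carrier G" for h k
  proof -
    have "commutator G h k = h \<otimes> (k \<otimes> inv h \<otimes> inv k)"
      using h k by (simp add: commutator_def m_assoc)
    then show ?thesis using h k by (simp add: N.inv_op_closed2)
  qed
  then have "{commutator G h k | h k. h \<in> lower_central G i \<and> k \<in> carrier G} \<subseteq> lower_central G i"
    by auto
  then have "commutator_subgroup G (lower_central G i) (carrier G) \<subseteq> lower_central G i"
    unfolding commutator_subgroup_eq by (rule generate_subgroup_incl) (rule N.subgroup_axioms)
  moreover have "lower_central G (Suc i) = commutator_subgroup G (lower_central G i) (carrier G)"
    by (rule lower_central_Suc) (use False in linarith)
  ultimately show ?thesis by (simp only:)
next
  case True
  have "lower_central G (Suc 0) \<subseteq> lower_central G 0" by simp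
  then show ?thesis unfolding True .
qed

lemma (in group) lower_central_antimono:
  assumes "i \<le> j" shows "lower_central G j \<subseteq> lower_central G i"
  using assms
proof (induction rule: dec_induct)
  case (step n)
  then show ?case using lower_central_Suc_subset[of n] by (rule_tac subset_trans)
qed (rule subset_refl)

text \<open>Iterated commutators of values of \<open>p\<close> are iterated commutators of values of \<open>q\<close>.  Taking the
  identity for \<open>q\<close> gives functoriality of the lower central series; taking the projection onto
  \<open>L Mod \<gamma>\<^sub>i(L)\<close> for \<open>q\<close> shows that \<open>p\<close> kills \<open>\<gamma>\<^sub>i(K)\<close>.\<close>

lemma image_lower_central_subset:
  assumes p: "group_hom K Q p" and q: "group_hom L Q q" and sub: "p ` carrier K \<subseteq> q ` carrier L"
  shows "p ` lower_central K i \<subseteq> q ` lower_central L i"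
proof -
  interpret p: group_hom K Q p by fact
  interpret q: group_hom L Q q by fact
  have "p ` lower_central K (Suc j) \<subseteq> q ` lower_central L (Suc j)" for j
  proof (induction j)
    case (Suc j)
    interpret L: normal "lower_central L (Suc (Suc j))" L by (rule q.G.lower_central_normal)
    let ?C = "{commutator K h k | h k. h \<in> lower_central K (Suc j) \<and> k \<in> carrier K}"
    have K: "lower_central K (Suc j) \<subseteq> carrier K" and L: "lower_central L (Suc j) \<subseteq> carrier L"
      using p.G.lower_central_normal q.G.lower_central_normal
      by (simp_all add: normal_imp_subgroup subgroup.subset)
    have "?C \<subseteq> carrier K" using K by auto
    then have "p ` generate K ?C = generate Q (p ` ?C)" by (simp add: p.generate_img)
    also have "\<dots> \<subseteq> q ` lower_central L (Suc (Suc j))"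
    proof (rule p.H.generate_subgroup_incl)
      show "subgroup (q ` lower_central L (Suc (Suc j))) Q"
        by (rule q.subgroup_img_is_subgroup) (rule L.subgroup_axioms)
      show "p ` ?C \<subseteq> q ` lower_central L (Suc (Suc j))"
      proof safe
        fix h k assume h: "h \<in> lower_central K (Suc j)" and k: "k \<in> carrier K"
        obtain h' where h': "h' \<in> lower_central L (Suc j)" "p h = q h'" using Suc h by blast
        obtain k' where k': "k' \<in> carrier L" "p k = q k'" using sub k by blast
        have "p (commutator K h k) = q (commutator L h' k')"
          using h k h' k' K L by (simp add: p.hom_commutator q.hom_commutator subsetD)
        then show "p (commutator K h k) \<in> q ` lower_central L (Suc (Suc j))"
          using q.G.commutator_in_lower_central[OF _ h'(1) k'(1)] by auto
      qed
    qed
    finally show ?case by (simp add: lower_central_Suc[of "Suc j"] commutator_subgroup_eq)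
  qed (use sub in simp)
  then show ?thesis by (cases i) (use sub in auto)
qed

section \<open>Commutators with central values\<close>

text \<open>The situation of \<open>N = \<gamma>\<^sub>i(G)\<close> and \<open>Q = G / \<gamma>\<^sub>i\<^sub>+\<^sub>2(G)\<close>: all commutators of \<open>N\<close> with \<open>G\<close> become
  central.  The commutator then induces a map \<open>N \<times> G \<rightarrow> Q\<close> that is multiplicative in both variables.\<close>

locale central_commutators = group_hom G Q \<pi>
  for G :: "('a, 'm) monoid_scheme" and Q :: "('b, 'n) monoid_scheme" and \<pi> +
  fixes N
  assumes N: "subgroup N G"
    and central: "\<lbrakk>h \<in> N; g \<in> carrier G; g' \<in> carrier G\<rbrakk> \<Longrightarrow>
      \<pi> (commutator G h g) \<otimes>\<^bsub>Q\<^esub> \<pi> g' = \<pi> g' \<otimes>\<^bsub>Q\<^esub> \<pi> (commutator G h g)"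
begin

lemma N_carrier [simp]: "h \<in> N \<Longrightarrow> h \<in> carrier G"
  by (rule subgroup.mem_carrier[OF N])

lemma commutator_conj:
  assumes "h \<in> N" "g \<in> carrier G" "y \<in> carrier G"
  shows "\<pi> y \<otimes>\<^bsub>Q\<^esub> \<pi> (commutator G h g) \<otimes>\<^bsub>Q\<^esub> inv\<^bsub>Q\<^esub> \<pi> y = \<pi> (commutator G h g)"
  using assms by (simp flip: central) (simp add: H.m_assoc)

text \<open>The factor \<open>y\<close> ranges over all of \<open>G\<close>, because in the identity
  \<open>[y h, g] = y [h, g] y\<inverse> [y, g]\<close> it is \<open>[h, g]\<close> that gets conjugated.  Successive approximation
  needs this generality, with \<open>y\<close> the current approximation and \<open>h\<close> its correction.\<close>

lemma \<pi>_commutator_mult_left: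
  assumes "y \<in> carrier G" "h \<in> N" "g \<in> carrier G"
  shows "\<pi> (commutator G (y \<otimes>\<^bsub>G\<^esub> h) g) = \<pi> (commutator G h g) \<otimes>\<^bsub>Q\<^esub> \<pi> (commutator G y g)"
  using assms by (simp add: G.commutator_mult_left commutator_conj)

lemma \<pi>_commutator_mult_right:
  assumes "h \<in> N" "g \<in> carrier G" "k \<in> carrier G"
  shows "\<pi> (commutator G h (g \<otimes>\<^bsub>G\<^esub> k)) = \<pi> (commutator G h g) \<otimes>\<^bsub>Q\<^esub> \<pi> (commutator G h k)"
  using assms by (simp add: G.commutator_mult_right commutator_conj)

lemma commutator_group_hom:
  assumes "h \<in> N"
  shows "group_hom G Q (\<lambda>g. \<pi> (commutator G h g))"
  by unfold_locales (auto intro!: homI simp: assms \<pi>_commutator_mult_right)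

text \<open>For fixed \<open>h\<close> the map \<open>g \<mapsto> \<pi> [h, g]\<close> is a homomorphism with pairwise commuting values, so it
  kills the derived subgroup.  For the lower central series this is
  \<open>[\<gamma>\<^sub>i, \<gamma>\<^sub>2] \<subseteq> \<gamma>\<^sub>i\<^sub>+\<^sub>2\<close>.\<close>

lemma \<pi>_commutator_derived:
  assumes h: "h \<in> N" and g: "g \<in> commutator_subgroup G (carrier G) (carrier G)"
  shows "\<pi> (commutator G h g) = \<one>\<^bsub>Q\<^esub>"
proof -
  let ?C = "{commutator G a b | a b. a \<in> carrier G \<and> b \<in> carrier G}"
  let ?\<chi> = "\<lambda>g. \<pi> (commutator G h g)"
  interpret \<chi>: group_hom G Q ?\<chi> by (rule commutator_group_hom[OF h])
  have "?\<chi> (commutator G a b) = \<one>\<^bsub>Q\<^esub>" if "a \<in> carrier G" "b \<in> carrier G" for a b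
  proof -
    have "?\<chi> (commutator G a b) = commutator Q (?\<chi> a) (?\<chi> b)"
      using that by (rule \<chi>.hom_commutator)
    moreover have "?\<chi> a \<otimes>\<^bsub>Q\<^esub> ?\<chi> b = ?\<chi> b \<otimes>\<^bsub>Q\<^esub> ?\<chi> a"
      using that h by (intro central) simp_all
    ultimately show ?thesis
      using that by (simp only: H.commutator_eq_one_iff \<chi>.hom_closed)
  qed
  then have "?\<chi> ` ?C \<subseteq> {\<one>\<^bsub>Q\<^esub>}" by auto
  then have "generate Q (?\<chi> ` ?C) \<subseteq> {\<one>\<^bsub>Q\<^esub>}"
    by (rule H.generate_subgroup_incl) (rule H.triv_subgroup)
  moreover have "?\<chi> ` generate G ?C = generate Q (?\<chi> ` ?C)"
    by (rule \<chi>.generate_img[symmetric]) auto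
  ultimately show ?thesis using g by (auto simp: commutator_subgroup_eq)
qed

end

section \<open>Products of commutators\<close>

definition commutator_product ::
  "('a, 'm) monoid_scheme \<Rightarrow> ('x \<Rightarrow> 'a) \<Rightarrow> ('x \<Rightarrow> 'a) \<Rightarrow> 'x list \<Rightarrow> 'a" where
  "commutator_product G y f xs = foldr (\<lambda>x r. commutator G (y x) (f x) \<otimes>\<^bsub>G\<^esub> r) xs \<one>\<^bsub>G\<^esub>"

lemma commutator_product_simps [simp]:
  "commutator_product G y f [] = \<one>\<^bsub>G\<^esub>"
  "commutator_product G y f (x # xs) = commutator G (y x) (f x) \<otimes>\<^bsub>G\<^esub> commutator_product G y f xs"
  by (simp_all add: commutator_product_def)

lemma (in group) commutator_product_closed [simp]:
  assumes "\<And>x. x \<in> set xs \<Longrightarrow> y x \<in> carrier G" "\<And>x. x \<in> set xs \<Longrightarrow> f x \<in> carrier G"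
  shows "commutator_product G y f xs \<in> carrier G"
  using assms by (induction xs) auto

lemma (in group_hom) hom_commutator_product:
  assumes "\<And>x. x \<in> set xs \<Longrightarrow> y x \<in> carrier G" "\<And>x. x \<in> set xs \<Longrightarrow> f x \<in> carrier G"
  shows "h (commutator_product G y f xs) =
    commutator_product H (\<lambda>x. h (y x)) (\<lambda>x. h (f x)) xs"
  using assms by (induction xs) (auto simp: hom_commutator)

lemma (in group) commutator_product_one:
  assumes "\<And>x. x \<in> set xs \<Longrightarrow> f x \<in> carrier G"
  shows "commutator_product G (\<lambda>x. \<one>) f xs = \<one>"
  using assms by (induction xs) auto

lemma (in group) commutator_product_single:
  assumes "distinct xs" "\<And>x. x \<in> set xs \<Longrightarrow> f x \<in> carrier G" "h \<in> carrier G"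
  shows "commutator_product G (\<lambda>x. if x = a then h else \<one>) f xs =
    (if a \<in> set xs then commutator G h (f a) else \<one>)"
  using assms by (induction xs) auto

context central_commutators
begin

lemma \<pi>_commutator_product_central:
  assumes "\<And>x. x \<in> set xs \<Longrightarrow> z x \<in> N" "\<And>x. x \<in> set xs \<Longrightarrow> f x \<in> carrier G" "g \<in> carrier G"
  shows "\<pi> (commutator_product G z f xs) \<otimes>\<^bsub>Q\<^esub> \<pi> g = \<pi> g \<otimes>\<^bsub>Q\<^esub> \<pi> (commutator_product G z f xs)"
  using assms
proof (induction xs)
  case (Cons x xs)
  let ?c = "\<pi> (commutator G (z x) (f x))" and ?p = "\<pi> (commutator_product G z f xs)"
  have "?c \<otimes>\<^bsub>Q\<^esub> ?p \<otimes>\<^bsub>Q\<^esub> \<pi> g = ?c \<otimes>\<^bsub>Q\<^esub> (\<pi> g \<otimes>\<^bsub>Q\<^esub> ?p)"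
    using Cons by (simp add: H.m_assoc)
  also have "\<dots> = (?c \<otimes>\<^bsub>Q\<^esub> \<pi> g) \<otimes>\<^bsub>Q\<^esub> ?p"
    using Cons.prems by (simp add: H.m_assoc)
  also have "\<dots> = \<pi> g \<otimes>\<^bsub>Q\<^esub> (?c \<otimes>\<^bsub>Q\<^esub> ?p)"
    using Cons.prems by (simp add: central[of "z x"] H.m_assoc)
  finally show ?case using Cons.prems by simp
qed simp

lemma \<pi>_commutator_product_mult:
  assumes "\<And>x. x \<in> set xs \<Longrightarrow> y x \<in> carrier G" "\<And>x. x \<in> set xs \<Longrightarrow> z x \<in> N"
    "\<And>x. x \<in> set xs \<Longrightarrow> f x \<in> carrier G"
  shows "\<pi> (commutator_product G (\<lambda>x. y x \<otimes>\<^bsub>G\<^esub> z x) f xs) =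
    \<pi> (commutator_product G z f xs) \<otimes>\<^bsub>Q\<^esub> \<pi> (commutator_product G y f xs)"
  using assms
proof (induction xs)
  case (Cons x xs)
  let ?cy = "commutator G (y x) (f x)" and ?cz = "\<pi> (commutator G (z x) (f x))"
  let ?py = "\<pi> (commutator_product G y f xs)" and ?pz = "\<pi> (commutator_product G z f xs)"
  have "\<pi> (commutator_product G (\<lambda>x. y x \<otimes>\<^bsub>G\<^esub> z x) f (x # xs)) =
      ?cz \<otimes>\<^bsub>Q\<^esub> \<pi> ?cy \<otimes>\<^bsub>Q\<^esub> (?pz \<otimes>\<^bsub>Q\<^esub> ?py)"
    using Cons by (simp add: \<pi>_commutator_mult_left)
  also have "\<dots> = ?cz \<otimes>\<^bsub>Q\<^esub> (\<pi> ?cy \<otimes>\<^bsub>Q\<^esub> ?pz) \<otimes>\<^bsub>Q\<^esub> ?py"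
    using Cons.prems by (simp add: H.m_assoc)
  also have "\<pi> ?cy \<otimes>\<^bsub>Q\<^esub> ?pz = ?pz \<otimes>\<^bsub>Q\<^esub> \<pi> ?cy"
    using Cons.prems by (simp add: \<pi>_commutator_product_central)
  finally show ?case using Cons.prems by (simp add: H.m_assoc)
qed simp

text \<open>By multiplicativity in the second variable it is enough to take commutators with generators of
  \<open>G\<close>, and by multiplicativity in the first variable the commutators with one and the same generator
  can be merged into a single factor.\<close>

lemma \<pi>_commutator_subgroup:
  assumes xs: "distinct xs" "set xs \<subseteq> carrier G" "generate G (set xs) = carrier G"
    and c: "c \<in> commutator_subgroup G N (carrier G)"
  obtains z where "\<And>x. z x \<in> N" "\<pi> c = \<pi> (commutator_product G z (\<lambda>x. x) xs)"
proof -
  define p where "p z = \<pi> (commutator_product G z (\<lambda>x. x) xs)" for z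
  define T where "T = p ` (UNIV \<rightarrow> N)"
  interpret N: subgroup N G by (rule N)
  have xsG: "x \<in> carrier G" if "x \<in> set xs" for x using that xs by auto
  have p_closed: "p z \<in> carrier Q" if "z \<in> UNIV \<rightarrow> N" for z
    using that xsG by (auto simp: p_def Pi_iff)
  have p_mult: "p (\<lambda>x. y x \<otimes>\<^bsub>G\<^esub> z x) = p z \<otimes>\<^bsub>Q\<^esub> p y" if "y \<in> UNIV \<rightarrow> N" "z \<in> UNIV \<rightarrow> N" for y z
    unfolding p_def by (rule \<pi>_commutator_product_mult) (use that xsG in \<open>auto simp: Pi_iff\<close>)
  have p_one: "p (\<lambda>x. \<one>\<^bsub>G\<^esub>) = \<one>\<^bsub>Q\<^esub>"
    using xsG by (simp add: p_def G.commutator_product_one)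
  have T: "subgroup T Q"
  proof (rule H.subgroupI)
    show "T \<subseteq> carrier Q" using p_closed by (auto simp: T_def)
    have "p (\<lambda>x. \<one>\<^bsub>G\<^esub>) \<in> T"
      unfolding T_def by (rule imageI) (rule Pi_I, rule N.one_closed)
    then show "T \<noteq> {}" by auto
    fix a assume "a \<in> T"
    then obtain y where y: "y \<in> UNIV \<rightarrow> N" "a = p y" by (auto simp: T_def)
    define y' where "y' x = inv\<^bsub>G\<^esub> y x" for x
    have y': "y' \<in> UNIV \<rightarrow> N" using y by (auto simp: y'_def Pi_iff)
    have "p y' \<otimes>\<^bsub>Q\<^esub> a = p (\<lambda>x. y x \<otimes>\<^bsub>G\<^esub> y' x)" using y y' by (simp add: p_mult)
    also have "(\<lambda>x. y x \<otimes>\<^bsub>G\<^esub> y' x) = (\<lambda>x. \<one>\<^bsub>G\<^esub>)" using y by (auto simp: y'_def Pi_iff)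
    finally have "inv\<^bsub>Q\<^esub> a = p y'"
      using p_one p_closed y y' by (intro H.inv_equality) auto
    then show "inv\<^bsub>Q\<^esub> a \<in> T" using y' by (auto simp: T_def)
    fix b assume "b \<in> T"
    then obtain z where z: "z \<in> UNIV \<rightarrow> N" "b = p z" by (auto simp: T_def)
    have "a \<otimes>\<^bsub>Q\<^esub> b = p (\<lambda>x. z x \<otimes>\<^bsub>G\<^esub> y x)" using y z by (simp add: p_mult)
    moreover have "(\<lambda>x. z x \<otimes>\<^bsub>G\<^esub> y x) \<in> UNIV \<rightarrow> N" using y z by auto
    ultimately show "a \<otimes>\<^bsub>Q\<^esub> b \<in> T" by (auto simp: T_def)
  qed
  \<comment> \<open>For fixed \<open>h\<close> the values \<open>\<pi> [h, g]\<close> form a homomorphic image of \<open>G\<close>, so it suffices to hit \<open>T\<close>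
    on generators.\<close>
  have comm: "\<pi> (commutator G h g) \<in> T" if h: "h \<in> N" and g: "g \<in> carrier G" for h g
  proof -
    let ?\<chi> = "\<lambda>g. \<pi> (commutator G h g)"
    interpret \<chi>: group_hom G Q ?\<chi> by (rule commutator_group_hom[OF h])
    have "?\<chi> x \<in> T" if "x \<in> set xs" for x
    proof -
      have "?\<chi> x = p (\<lambda>x'. if x' = x then h else \<one>\<^bsub>G\<^esub>)"
        using that h xs xsG by (simp add: p_def G.commutator_product_single)
      moreover have "(\<lambda>x'. if x' = x then h else \<one>\<^bsub>G\<^esub>) \<in> UNIV \<rightarrow> N" using h by auto
      ultimately show ?thesis by (auto simp: T_def)
    qed
    then have "generate Q (?\<chi> ` set xs) \<subseteq> T"
      by (intro H.generate_subgroup_incl T) auto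
    then have "?\<chi> ` carrier G \<subseteq> T" using \<chi>.generate_img[OF xs(2)] xs(3) by simp
    then show ?thesis using g by auto
  qed
  let ?C = "{commutator G h g | h g. h \<in> N \<and> g \<in> carrier G}"
  have "generate Q (\<pi> ` ?C) \<subseteq> T"
    using comm by (intro H.generate_subgroup_incl T) auto
  moreover have "?C \<subseteq> carrier G" by auto
  ultimately have "\<pi> c \<in> T" using generate_img[of ?C] c by (auto simp: commutator_subgroup_eq)
  then show ?thesis using that by (auto simp: T_def p_def)
qed

end

lemma (in group) central_commutators_lower_central:
  assumes "i \<ge> 1"
  shows "central_commutators G (G Mod lower_central G (Suc (Suc i)))
    (\<lambda>x. lower_central G (Suc (Suc i)) #> x) (lower_central G i)"
proof -
  let ?N = "lower_central G (Suc (Suc i))"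
  interpret M: normal "lower_central G i" G by (rule lower_central_normal)
  interpret N: normal ?N G by (rule lower_central_normal)
  interpret q: group_hom G "G Mod ?N" "\<lambda>x. ?N #> x" by (rule N.coset_group_hom)
  show ?thesis
  proof unfold_locales
    fix h g g' assume h: "h \<in> lower_central G i" and g: "g \<in> carrier G" "g' \<in> carrier G"
    let ?c = "commutator G h g"
    have "commutator G ?c g' \<in> ?N"
      using assms h g by (intro commutator_in_lower_central) auto
    then have "?N #> commutator G ?c g' = \<one>\<^bsub>G Mod ?N\<^esub>"
      using h g by (simp add: N.coset_eq_self_iff)
    then have "commutator (G Mod ?N) (?N #> ?c) (?N #> g') = \<one>\<^bsub>G Mod ?N\<^esub>"
      using h g by (simp only: q.hom_commutator[symmetric] commutator_closed M.mem_carrier)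
    then show "(?N #> ?c) \<otimes>\<^bsub>G Mod ?N\<^esub> (?N #> g') = (?N #> g') \<otimes>\<^bsub>G Mod ?N\<^esub> (?N #> ?c)"
      using h g by (subst (asm) q.H.commutator_eq_one_iff) (auto simp del: q.hom_mult)
  qed
qed

text \<open>A subgroup that covers \<open>G/\<gamma>\<^sub>2\<close> covers \<open>G/\<gamma>\<^sub>i\<close>.  If it covers \<open>G/\<gamma>\<^sub>i\<close>, consider a generator \<open>[h, g]\<close>
  of \<open>\<gamma>\<^sub>i\<close>, with \<open>h\<close> in \<open>\<gamma>\<^sub>i\<^sub>-\<^sub>1\<close>.  Write \<open>h = u a\<close> and \<open>g = v b\<close> with \<open>a\<close>, \<open>b\<close> in \<open>A\<close>, \<open>u\<close> in \<open>\<gamma>\<^sub>i\<close> and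
  \<open>v\<close> in \<open>\<gamma>\<^sub>2\<close>.  Neither \<open>u\<close> nor \<open>v\<close> matters modulo \<open>\<gamma>\<^sub>i\<^sub>+\<^sub>1\<close>, so \<open>[h, g]\<close> agrees with the element
  \<open>[a, b]\<close> of \<open>A\<close> there.\<close>

lemma (in group) lower_central_set_mult_eq_carrier:
  assumes A: "subgroup A G" and gen: "lower_central G 2 <#> A = carrier G" and i: "i \<ge> 1"
  shows "lower_central G i <#> A = carrier G"
proof -
  interpret A: subgroup A G by fact
  have sub: "subgroup (lower_central G j <#> A) G" for j
    using A lower_central_normal mult_norm_subgroup by blast
  have decomp: "\<exists>u\<in>lower_central G j. \<exists>a\<in>A. g = u \<otimes> a"
    if "lower_central G j <#> A = carrier G" "g \<in> carrier G" for j g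
    using that unfolding set_mult_def by blast
  have *: "lower_central G (Suc (Suc k)) <#> A = carrier G" for k
  proof (induction k)
    case 0
    then show ?case using gen by (simp add: numeral_2_eq_2)
  next
    case (Suc k)
    let ?N = "lower_central G (Suc (Suc (Suc k)))"
    let ?S = "?N <#> A"
    interpret N: normal ?N G by (rule lower_central_normal)
    interpret K: normal "lower_central G (Suc (Suc k))" G by (rule lower_central_normal)
    interpret L: normal "lower_central G (Suc k)" G by (rule lower_central_normal)
    interpret S: subgroup ?S G by (rule sub)
    interpret q: group_hom G "G Mod ?N" "\<lambda>x. ?N #> x" by (rule N.coset_group_hom)
    have C: "central_commutators G (G Mod ?N) (\<lambda>x. ?N #> x) (lower_central G (Suc k))"
      by (rule central_commutators_lower_central) simp
    have comm: "commutator G h g \<in> ?S" if h: "h \<in> lower_central G (Suc k)" and g: "g \<in> carrier G" for h g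
    proof -
      obtain u a where u: "u \<in> lower_central G (Suc (Suc k))" and a: "a \<in> A" and h_eq: "h = u \<otimes> a"
        using decomp[OF Suc L.mem_carrier[OF h]] by auto
      obtain v b where v: "v \<in> lower_central G 2" and b: "b \<in> A" and g_eq: "g = v \<otimes> b"
        using decomp[OF gen g] by auto
      have vG: "v \<in> carrier G"
        by (rule subgroup.mem_carrier[OF normal_imp_subgroup[OF lower_central_normal] v])
      have "u \<in> lower_central G (Suc k)" by (rule subsetD[OF lower_central_Suc_subset u])
      moreover have "a = inv u \<otimes> h" using u a h_eq by (simp add: inv_cancel_left)
      ultimately have aL: "a \<in> lower_central G (Suc k)" using h by simp
      have 1: "?N #> commutator G u g = \<one>\<^bsub>G Mod ?N\<^esub>"
        using u g commutator_in_lower_central[of "Suc (Suc k)" u g]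
        by (simp add: N.coset_eq_self_iff)
      have 2: "?N #> commutator G a v = \<one>\<^bsub>G Mod ?N\<^esub>"
        using central_commutators.\<pi>_commutator_derived[OF C aL] v by (simp add: numeral_2_eq_2 lower_central_Suc)
      have "?N #> commutator G h g =
          (?N #> commutator G a g) \<otimes>\<^bsub>G Mod ?N\<^esub> (?N #> commutator G u g)"
        unfolding h_eq
        by (rule central_commutators.\<pi>_commutator_mult_left[OF C K.mem_carrier[OF u] aL g])
      also have "\<dots> = ?N #> commutator G a g"
        unfolding 1 using a g by (intro q.H.r_one q.hom_closed) simp
      also have "\<dots> =
          (?N #> commutator G a v) \<otimes>\<^bsub>G Mod ?N\<^esub> (?N #> commutator G a b)"
        unfolding g_eq
        by (rule central_commutators.\<pi>_commutator_mult_right[OF C aL vG A.mem_carrier[OF b]])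
      also have "\<dots> = ?N #> commutator G a b"
        unfolding 2 using a b by (intro q.H.l_one q.hom_closed) simp
      finally have "commutator G h g \<in> ?N #> commutator G a b"
        using h g rcos_self[OF _ N.subgroup_axioms, of "commutator G h g"] by simp
      moreover have "commutator G a b \<in> A" using a b by (simp add: commutator_def)
      ultimately show ?thesis by (auto simp: r_coset_def set_mult_def)
    qed
    have K_sub: "lower_central G (Suc (Suc k)) \<subseteq> ?S"
      unfolding lower_central.simps(3)[of G k] commutator_subgroup_eq
      by (rule generate_subgroup_incl[OF _ sub]) (clarify, rule comm)
    have A_sub: "a \<in> ?S" if "a \<in> A" for a
    proof -
      have "\<one> \<otimes> a \<in> ?S" unfolding set_mult_def using N.one_closed that by blast
      then show ?thesis using that by simp
    qed
    have "carrier G \<subseteq> ?S"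
    proof
      fix g assume "g \<in> carrier G"
      from decomp[OF Suc this]
      obtain u a where "u \<in> lower_central G (Suc (Suc k))" "a \<in> A" "g = u \<otimes> a"
        by auto
      then show "g \<in> ?S" using subsetD[OF K_sub] A_sub by simp
    qed
    then show ?case using S.subset by (rule equalityI[rotated])
  qed
  show ?thesis
  proof (cases "i = 1")
    case True
    have "g \<in> carrier G <#> A" if "g \<in> carrier G" for g
    proof -
      have "g \<otimes> \<one> \<in> carrier G <#> A" unfolding set_mult_def using that A.one_closed by blast
      then show ?thesis using that by simp
    qed
    moreover have "carrier G <#> A \<subseteq> carrier G" by (rule setmult_subset_G[OF subset_refl A.subset])
    ultimately have "carrier G <#> A = carrier G" by auto
    then show ?thesis using True by simp
  next
    case False
    then have "i = Suc (Suc (i - 2))" using i by linarith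
    then show ?thesis using *[of "i - 2"] by simp
  qed
qed

section \<open>The pronilpotent completion\<close>

text \<open>Elements of the completion are handled through sequences of representatives in \<open>G\<close>.  Only
  consecutive terms are compared; \<open>coherent_coset_eq\<close> recovers all pairs.  The value at \<open>0\<close>, where
  there is no coset, is only required to lie in \<open>G\<close>.\<close>

definition coherent :: "('a, 'm) monoid_scheme \<Rightarrow> (nat \<Rightarrow> 'a) \<Rightarrow> bool" where
  "coherent G r \<longleftrightarrow> (\<forall>i. r i \<in> carrier G) \<and>
    (\<forall>i\<ge>1. lower_central G i #>\<^bsub>G\<^esub> r (Suc i) = lower_central G i #>\<^bsub>G\<^esub> r i)"

definition coset_sequence :: "('a, 'm) monoid_scheme \<Rightarrow> (nat \<Rightarrow> 'a) \<Rightarrow> nat \<Rightarrow> 'a set" where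
  "coset_sequence G r = (\<lambda>i\<in>{1..}. lower_central G i #>\<^bsub>G\<^esub> r i)"

lemma completion_map_eq: "completion_map G x = coset_sequence G (\<lambda>_. x)"
  by (simp add: completion_map_def coset_sequence_def)

lemma coset_sequence_apply: "i \<ge> 1 \<Longrightarrow> coset_sequence G r i = lower_central G i #>\<^bsub>G\<^esub> r i"
  by (simp add: coset_sequence_def)

lemma coset_sequence_extensional: "coset_sequence G r \<in> extensional {1..}"
  by (simp add: coset_sequence_def)

lemma coherent_closed: "coherent G r \<Longrightarrow> r i \<in> carrier G"
  by (simp add: coherent_def)

context group
begin

lemma lower_central_coset_hom:
  "group_hom G (G Mod lower_central G i) (\<lambda>x. lower_central G i #> x)"
  by (rule normal.coset_group_hom[OF lower_central_normal])

lemma lower_central_coset_mono: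
  assumes "i \<le> j" "x \<in> carrier G" "y \<in> carrier G" "lower_central G j #> x = lower_central G j #> y"
  shows "lower_central G i #> x = lower_central G i #> y"
  using lower_central_normal lower_central_normal lower_central_antimono[OF assms(1)] assms(2-4)
  by (rule coset_eq_mono)

lemma coherent_coset_eq:
  assumes r: "coherent G r" and "1 \<le> i" "i \<le> j"
  shows "lower_central G i #> r j = lower_central G i #> r i"
  using \<open>i \<le> j\<close>
proof (induction rule: dec_induct)
  case (step n)
  have "lower_central G n #> r (Suc n) = lower_central G n #> r n"
    using r step \<open>1 \<le> i\<close> by (simp add: coherent_def)
  then have "lower_central G i #> r (Suc n) = lower_central G i #> r n"
    using step r by (intro lower_central_coset_mono[of i n]) (simp_all add: coherent_closed)
  then show ?case using step.IH by simp
qed simp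

lemma quotient_map_lower_central:
  assumes "i \<le> j" "x \<in> carrier G"
  shows "quotient_map G (lower_central G i) (\<lambda>x. x) (lower_central G j #> x) = lower_central G i #> x"
  using lower_central_antimono[OF assms(1)] assms(2)
  by (intro quotient_map_coset) (auto simp: lower_central_normal hom_def)

lemma completion_carrier_iff:
  "s \<in> carrier (pronilpotent_completion G) \<longleftrightarrow>
    s \<in> (\<Pi>\<^sub>E i\<in>{1..}. carrier (G Mod lower_central G i)) \<and>
    (\<forall>i j. 1 \<le> i \<and> i \<le> j \<longrightarrow> quotient_map G (lower_central G i) (\<lambda>x. x) (s j) = s i)"
  by (simp add: pronilpotent_completion_def Let_def)

lemma coset_sequence_in_completion:
  assumes r: "coherent G r"
  shows "coset_sequence G r \<in> carrier (pronilpotent_completion G)"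
  unfolding completion_carrier_iff
proof (intro conjI allI impI)
  show "coset_sequence G r \<in> (\<Pi>\<^sub>E i\<in>{1..}. carrier (G Mod lower_central G i))"
    by (simp add: coset_sequence_def carrier_FactGroup coherent_closed[OF r])
  fix i j :: nat assume ij: "1 \<le> i \<and> i \<le> j"
  then have "lower_central G i #> r j = lower_central G i #> r i"
    by (intro coherent_coset_eq[OF r]) simp_all
  then show "quotient_map G (lower_central G i) (\<lambda>x. x) (coset_sequence G r j) = coset_sequence G r i"
    using ij by (simp add: coset_sequence_apply quotient_map_lower_central coherent_closed[OF r])
qed

lemma completion_coset_sequence:
  assumes s: "s \<in> carrier (pronilpotent_completion G)"
  obtains r where "coherent G r" "s = coset_sequence G r"
proof -
  have "\<exists>x\<in>carrier G. i \<ge> 1 \<longrightarrow> s i = lower_central G i #> x" for i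
  proof (cases "i \<ge> 1")
    case True
    then have "s i \<in> carrier (G Mod lower_central G i)"
      using s unfolding completion_carrier_iff by (auto dest!: PiE_mem[of s _ _ i])
    then show ?thesis by (auto simp: carrier_FactGroup)
  qed auto
  then obtain r where r: "\<And>i. r i \<in> carrier G" "\<And>i. i \<ge> 1 \<Longrightarrow> s i = lower_central G i #> r i"
    by metis
  have "lower_central G i #> r (Suc i) = lower_central G i #> r i" if "i \<ge> 1" for i
  proof -
    have "quotient_map G (lower_central G i) (\<lambda>x. x) (s (Suc i)) = s i"
      using s that unfolding completion_carrier_iff by simp
    then show ?thesis using that r by (simp add: quotient_map_lower_central)
  qed
  then have "coherent G r" using r by (simp add: coherent_def)
  moreover have "s \<in> extensional {1..}"
    using s unfolding completion_carrier_iff PiE_def by simp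
  then have "s = coset_sequence G r"
    by (rule extensionalityI[OF _ coset_sequence_extensional]) (simp add: r coset_sequence_apply)
  ultimately show ?thesis by (rule that)
qed

lemma coherent_const: "x \<in> carrier G \<Longrightarrow> coherent G (\<lambda>_. x)"
  by (simp add: coherent_def)

lemma coherent_mult:
  assumes r: "coherent G r" and t: "coherent G t"
  shows "coherent G (\<lambda>i. r i \<otimes> t i)"
proof -
  have "lower_central G i #> (r (Suc i) \<otimes> t (Suc i)) = lower_central G i #> (r i \<otimes> t i)"
    if "i \<ge> 1" for i
    using r t that
    by (simp add: coherent_def normal.rcos_sum[OF lower_central_normal, symmetric])
  then show ?thesis using r t by (simp add: coherent_def)
qed

lemma coherent_inv:
  assumes r: "coherent G r"
  shows "coherent G (\<lambda>i. inv r i)"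
proof -
  have "lower_central G i #> inv r (Suc i) = lower_central G i #> inv r i" if "i \<ge> 1" for i
    using r that group_hom.hom_inv[OF lower_central_coset_hom, of "r i" i]
      group_hom.hom_inv[OF lower_central_coset_hom, of "r (Suc i)" i]
    by (simp add: coherent_def)
  then show ?thesis using r by (simp add: coherent_def)
qed

lemma completion_one: "\<one>\<^bsub>pronilpotent_completion G\<^esub> = coset_sequence G (\<lambda>_. \<one>)"
proof -
  have "lower_central G i #> \<one> = lower_central G i" for i
    by (rule coset_mult_one)
      (rule subgroup.subset[OF normal_imp_subgroup[OF lower_central_normal]])
  then show ?thesis
    by (simp add: pronilpotent_completion_def Let_def coset_sequence_def)
qed

lemma completion_mult:
  "s \<otimes>\<^bsub>pronilpotent_completion G\<^esub> t = (\<lambda>i\<in>{1..}. s i \<otimes>\<^bsub>G Mod lower_central G i\<^esub> t i)"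
  by (simp add: pronilpotent_completion_def Let_def)

lemma coset_sequence_mult:
  assumes "coherent G r" "coherent G t"
  shows "coset_sequence G r \<otimes>\<^bsub>pronilpotent_completion G\<^esub> coset_sequence G t =
    coset_sequence G (\<lambda>i. r i \<otimes> t i)"
  unfolding completion_mult
  using assms by (simp add: coset_sequence_def coherent_closed
      normal.rcos_sum[OF lower_central_normal] cong: restrict_cong)

lemma completion_group: "group (pronilpotent_completion G)"
proof (rule groupI)
  let ?P = "pronilpotent_completion G"
  show "\<one>\<^bsub>?P\<^esub> \<in> carrier ?P"
    unfolding completion_one by (intro coset_sequence_in_completion coherent_const) simp
  fix s assume "s \<in> carrier ?P"
  then obtain r where r: "coherent G r" "s = coset_sequence G r" by (rule completion_coset_sequence)
  show "\<one>\<^bsub>?P\<^esub> \<otimes>\<^bsub>?P\<^esub> s = s"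
    using r by (simp add: completion_one coset_sequence_mult coherent_const coherent_closed)
  have "coset_sequence G (\<lambda>i. inv r i) \<otimes>\<^bsub>?P\<^esub> s = \<one>\<^bsub>?P\<^esub>"
    using r by (simp add: completion_one coset_sequence_mult coherent_inv coherent_closed)
  moreover have "coset_sequence G (\<lambda>i. inv r i) \<in> carrier ?P"
    using r by (intro coset_sequence_in_completion coherent_inv)
  ultimately show "\<exists>t\<in>carrier ?P. t \<otimes>\<^bsub>?P\<^esub> s = \<one>\<^bsub>?P\<^esub>" by (rule bexI)
  fix t assume "t \<in> carrier ?P"
  then obtain r' where r': "coherent G r'" "t = coset_sequence G r'"
    by (rule completion_coset_sequence)
  show "s \<otimes>\<^bsub>?P\<^esub> t \<in> carrier ?P"
    using r r' by (simp add: coset_sequence_mult coset_sequence_in_completion coherent_mult)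
  fix u assume "u \<in> carrier ?P"
  then obtain r'' where r'': "coherent G r''" "u = coset_sequence G r''"
    by (rule completion_coset_sequence)
  show "s \<otimes>\<^bsub>?P\<^esub> t \<otimes>\<^bsub>?P\<^esub> u = s \<otimes>\<^bsub>?P\<^esub> (t \<otimes>\<^bsub>?P\<^esub> u)"
    using r r' r'' by (simp add: coset_sequence_mult coherent_mult coherent_closed m_assoc)
qed

lemma completion_projection_hom:
  assumes "i \<ge> 1"
  shows "group_hom (pronilpotent_completion G) (G Mod lower_central G i) (\<lambda>s. s i)"
  unfolding group_hom_def group_hom_axioms_def
proof (intro conjI completion_group normal.factorgroup_is_group[OF lower_central_normal] homI)
  fix s t
  assume s: "s \<in> carrier (pronilpotent_completion G)"
  then show "s i \<in> carrier (G Mod lower_central G i)"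
    using assms unfolding completion_carrier_iff by (auto dest!: PiE_mem[of s _ _ i])
  show "(s \<otimes>\<^bsub>pronilpotent_completion G\<^esub> t) i = s i \<otimes>\<^bsub>G Mod lower_central G i\<^esub> t i"
    unfolding completion_mult using assms by simp
qed

lemma completion_map_hom: "group_hom G (pronilpotent_completion G) (completion_map G)"
  unfolding group_hom_def group_hom_axioms_def
  by (intro conjI completion_group is_group homI)
    (simp_all add: completion_map_eq coset_sequence_in_completion coherent_const coset_sequence_mult)

lemma completion_eqI:
  assumes "s \<in> carrier (pronilpotent_completion G)" "t \<in> carrier (pronilpotent_completion G)"
    and "\<And>i. i \<ge> 1 \<Longrightarrow> s i = t i"
  shows "s = t"
  using assms unfolding completion_carrier_iff by (auto simp: PiE_iff intro!: extensionalityI)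

end

section \<open>Commutator products in the completion\<close>

text \<open>One step of the successive approximation: the error \<open>g \<cdot> (\<Prod>[y x, x])\<inverse>\<close> is, modulo the next term of
  the series, a product of commutators \<open>[z x, x]\<close> with \<open>z x\<close> one term further up, and
  \<open>y' x = y x \<cdot> z x\<close> absorbs it.\<close>

lemma (in group) refine_commutator_product:
  assumes xs: "distinct xs" "set xs \<subseteq> carrier G" "generate G (set xs) = carrier G"
    and y: "\<And>x. y x \<in> carrier G" and g: "g \<in> carrier G"
    and approx: "lower_central G (Suc (Suc k)) #> commutator_product G y (\<lambda>x. x) xs =
      lower_central G (Suc (Suc k)) #> g"
  obtains y' where "\<And>x. y' x \<in> carrier G"
    and "\<And>x. lower_central G (Suc k) #> y' x = lower_central G (Suc k) #> y x"
    and "lower_central G (Suc (Suc (Suc k))) #> commutator_product G y' (\<lambda>x. x) xs =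
      lower_central G (Suc (Suc (Suc k))) #> g"
proof -
  let ?N = "lower_central G (Suc (Suc (Suc k)))" and ?M = "lower_central G (Suc k)"
  let ?p = "\<lambda>y. commutator_product G y (\<lambda>x. x) xs"
  have C: "central_commutators G (G Mod ?N) (\<lambda>x. ?N #> x) ?M"
    by (rule central_commutators_lower_central) simp
  interpret M: normal ?M G by (rule lower_central_normal)
  interpret q: group_hom G "G Mod ?N" "\<lambda>x. ?N #> x" by (rule lower_central_coset_hom)
  have xsG: "x \<in> carrier G" if "x \<in> set xs" for x using xs(2) that by (rule subsetD)
  have py: "?p y \<in> carrier G" by (rule commutator_product_closed) (simp_all add: y xsG)
  let ?c = "g \<otimes> inv (?p y)"
  have "?c \<in> lower_central G (Suc (Suc k))"
    using normal.coset_eq_iff[OF lower_central_normal[of "Suc (Suc k)"] g py] approx by simp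
  then have "?c \<in> commutator_subgroup G ?M (carrier G)" by (simp add: lower_central_Suc)
  from central_commutators.\<pi>_commutator_subgroup[OF C xs this]
  obtain z where z: "\<And>x. z x \<in> ?M" and cz: "?N #> ?c = ?N #> ?p z" by metis
  show ?thesis
  proof (rule that)
    show "y x \<otimes> z x \<in> carrier G" for x using y z by simp
    show "?M #> (y x \<otimes> z x) = ?M #> y x" for x
      using y z by (subst M.coset_eq_iff) (simp_all add: M.inv_op_closed2)
    have "?N #> ?p (\<lambda>x. y x \<otimes> z x) = (?N #> ?p z) \<otimes>\<^bsub>G Mod ?N\<^esub> (?N #> ?p y)"
      by (rule central_commutators.\<pi>_commutator_product_mult[OF C y z xsG])
    also have "\<dots> = ?N #> (?c \<otimes> ?p y)"
      unfolding cz[symmetric] using py g by (intro q.hom_mult[symmetric]) simp_all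
    also have "?c \<otimes> ?p y = g" using py g by (simp add: m_assoc)
    finally show "?N #> ?p (\<lambda>x. y x \<otimes> z x) = ?N #> g" .
  qed
qed

text \<open>The hypothesis on \<open>r 2\<close> makes the constant \<open>\<one>\<close> a first approximation.  The \<open>k\<close>-th approximation is
  correct modulo \<open>\<gamma>\<^sub>k\<^sub>+\<^sub>2\<close>, and its successor differs from it only within \<open>\<gamma>\<^sub>k\<^sub>+\<^sub>1\<close>, so the sequence is
  coherent.\<close>

lemma (in group) commutator_product_approximations:
  assumes xs: "distinct xs" "set xs \<subseteq> carrier G" "generate G (set xs) = carrier G"
    and r: "coherent G r" and r2: "r 2 \<in> lower_central G 2"
  obtains Y where "\<And>x. coherent G (\<lambda>k. Y k x)"
    and "\<And>k. lower_central G (Suc (Suc k)) #> commutator_product G (Y k) (\<lambda>x. x) xs =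
      lower_central G (Suc (Suc k)) #> r (Suc (Suc k))"
proof -
  let ?p = "\<lambda>y. commutator_product G y (\<lambda>x. x) xs"
  let ?A = "\<lambda>k y. (\<forall>x. y x \<in> carrier G) \<and>
    lower_central G (Suc (Suc k)) #> ?p y = lower_central G (Suc (Suc k)) #> r (Suc (Suc k))"
  let ?R = "\<lambda>k y y'. \<forall>x. lower_central G (Suc k) #> y' x = lower_central G (Suc k) #> y x"
  have xsG: "x \<in> carrier G" if "x \<in> set xs" for x using xs(2) that by (rule subsetD)
  have p_closed: "?p y \<in> carrier G" if "\<And>x. y x \<in> carrier G" for y
    using that xsG by simp
  have "\<exists>Y. \<forall>k. ?A k (Y k) \<and> ?R k (Y k) (Y (Suc k))"
  proof (rule dependent_nat_choice)
    have "?p (\<lambda>x. \<one>) = \<one>" by (rule commutator_product_one) (rule xsG)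
    moreover have "lower_central G 2 #> r 2 = lower_central G 2 #> \<one>"
      using r2 coherent_closed[OF r]
      by (subst normal.coset_eq_iff[OF lower_central_normal]) simp_all
    ultimately have "?A 0 (\<lambda>x. \<one>)" by (simp add: numeral_2_eq_2)
    then show "\<exists>y. ?A 0 y" by (rule exI[of _ "\<lambda>x. \<one>"])
  next
    fix y k assume A: "?A k y"
    have "lower_central G (Suc (Suc k)) #> r (Suc (Suc (Suc k))) =
        lower_central G (Suc (Suc k)) #> r (Suc (Suc k))"
      using r by (simp add: coherent_def)
    then have "lower_central G (Suc (Suc k)) #> ?p y =
        lower_central G (Suc (Suc k)) #> r (Suc (Suc (Suc k)))"
      using A by simp
    then obtain y' where "\<And>x. y' x \<in> carrier G" "?R k y y'"
      "lower_central G (Suc (Suc (Suc k))) #> ?p y' =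
        lower_central G (Suc (Suc (Suc k))) #> r (Suc (Suc (Suc k)))"
      using refine_commutator_product[OF xs, of y "r (Suc (Suc (Suc k)))" k] A coherent_closed[OF r]
      by metis
    then have "?A (Suc k) y' \<and> ?R k y y'" by simp
    then show "\<exists>y'. ?A (Suc k) y' \<and> ?R k y y'" by (rule exI[of _ y'])
  qed
  then obtain Y where Y: "\<And>k. ?A k (Y k)" "\<And>k. ?R k (Y k) (Y (Suc k))" by metis
  have "coherent G (\<lambda>k. Y k x)" for x
    unfolding coherent_def
  proof (intro conjI allI impI)
    show "Y k x \<in> carrier G" for k using Y by simp
    show "lower_central G k #> Y (Suc k) x = lower_central G k #> Y k x" for k
      using Y by (intro lower_central_coset_mono[of k "Suc k"]) simp_all
  qed
  then show ?thesis using Y(1) by (intro that[of Y]) simp_all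
qed

text \<open>The completion is generated by the image of \<open>G\<close> modulo its commutators, with a bound on the number
  of commutators.  Dividing by the representative at level \<open>2\<close> moves the element into the kernel of
  the projection to \<open>G/\<gamma>\<^sub>2\<close>, where \<open>commutator_product_approximations\<close> applies.\<close>

lemma (in group) completion_commutator_product:
  assumes xs: "distinct xs" "set xs \<subseteq> carrier G" "generate G (set xs) = carrier G"
    and s: "s \<in> carrier (pronilpotent_completion G)"
  obtains y f where "\<forall>x. y x \<in> carrier (pronilpotent_completion G)" and "f \<in> carrier G"
    and "s = commutator_product (pronilpotent_completion G) y (completion_map G) xs
      \<otimes>\<^bsub>pronilpotent_completion G\<^esub> completion_map G f"
proof -
  let ?P = "pronilpotent_completion G" and ?c = "completion_map G"
  interpret c: group_hom G ?P ?c by (rule completion_map_hom)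
  obtain r where r: "coherent G r" and s_eq: "s = coset_sequence G r"
    using s by (rule completion_coset_sequence)
  have rG: "r i \<in> carrier G" for i by (rule coherent_closed[OF r])
  let ?r = "\<lambda>i. r i \<otimes> inv (r 2)"
  have "coherent G ?r" using r by (intro coherent_mult coherent_const) (simp_all add: rG)
  moreover have "?r 2 \<in> lower_central G 2"
    using subgroup.one_closed[OF normal_imp_subgroup[OF lower_central_normal]] by (simp add: rG)
  ultimately obtain Y where Y: "\<And>x. coherent G (\<lambda>k. Y k x)"
    and approx: "\<And>k. lower_central G (Suc (Suc k)) #> commutator_product G (Y k) (\<lambda>x. x) xs =
      lower_central G (Suc (Suc k)) #> ?r (Suc (Suc k))"
    using commutator_product_approximations[OF xs] by metis
  have YG: "Y k x \<in> carrier G" for k x using coherent_closed[OF Y] .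
  have xsG: "x \<in> carrier G" if "x \<in> set xs" for x using xs(2) that by (rule subsetD)
  define y where "y x = coset_sequence G (\<lambda>k. Y k x)" for x
  have y: "y x \<in> carrier ?P" for x
    unfolding y_def by (rule coset_sequence_in_completion[OF Y])
  have y_prod: "commutator_product ?P y ?c xs \<in> carrier ?P"
    using y xsG by simp
  show ?thesis
  proof (rule that[OF _ rG[of 2]])
    show "\<forall>x. y x \<in> carrier ?P" using y by (rule allI)
    show "s = commutator_product ?P y ?c xs \<otimes>\<^bsub>?P\<^esub> ?c (r 2)"
    proof (rule completion_eqI)
      show "s \<in> carrier ?P" by (rule s)
      show "commutator_product ?P y ?c xs \<otimes>\<^bsub>?P\<^esub> ?c (r 2) \<in> carrier ?P"
        using y_prod rG by simp
      fix i :: nat assume i: "i \<ge> 1"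
      let ?Q = "G Mod lower_central G i"
      interpret p: group_hom ?P ?Q "\<lambda>s. s i" by (rule completion_projection_hom[OF i])
      interpret q: group_hom G ?Q "\<lambda>x. lower_central G i #> x" by (rule lower_central_coset_hom)
      have c_i: "?c x i = lower_central G i #> x" for x
        using i by (simp add: completion_map_eq coset_sequence_apply)
      have y_i: "y x i = lower_central G i #> Y i x" for x
        using i by (simp add: y_def coset_sequence_apply)
      have "commutator_product ?P y ?c xs i = commutator_product ?Q (\<lambda>x. y x i) (\<lambda>x. ?c x i) xs"
        using y xsG by (intro p.hom_commutator_product) simp_all
      also have "\<dots> = lower_central G i #> commutator_product G (Y i) (\<lambda>x. x) xs"
        unfolding c_i y_i using YG xsG by (intro q.hom_commutator_product[symmetric]) simp_all
      \<comment> \<open>\<open>Y i\<close> is accurate modulo \<open>\<gamma>\<^sub>i\<^sub>+\<^sub>2\<close>, hence modulo \<open>\<gamma>\<^sub>i\<close>.\<close>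
      also have "\<dots> = lower_central G i #> ?r (Suc (Suc i))"
        by (rule lower_central_coset_mono[OF _ _ _ approx]) (simp_all add: YG xsG rG)
      also have "\<dots> = lower_central G i #> ?r i"
        using \<open>coherent G ?r\<close> i by (intro coherent_coset_eq) simp_all
      finally have prod_i: "commutator_product ?P y ?c xs i = lower_central G i #> ?r i" .
      have "(commutator_product ?P y ?c xs \<otimes>\<^bsub>?P\<^esub> ?c (r 2)) i =
          (lower_central G i #> ?r i) \<otimes>\<^bsub>?Q\<^esub> (lower_central G i #> r 2)"
        unfolding prod_i[symmetric] c_i[of "r 2", symmetric] using y_prod rG by (intro p.hom_mult) simp_all
      also have "\<dots> = lower_central G i #> (?r i \<otimes> r 2)"
        using rG by (intro q.hom_mult[symmetric]) simp_all
      also have "?r i \<otimes> r 2 = r i" using rG by (simp add: m_assoc)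
      also have "lower_central G i #> r i = s i" using i by (simp add: s_eq coset_sequence_apply)
      finally show "s i = (commutator_product ?P y ?c xs \<otimes>\<^bsub>?P\<^esub> ?c (r 2)) i" by simp
    qed
  qed
qed

section \<open>Recognising parafree subgroups\<close>

lemma (in group) commutator_product_in_lower_central_2:
  assumes S: "subgroup S G"
    and "\<And>x. x \<in> set xs \<Longrightarrow> y x \<in> S" "\<And>x. x \<in> set xs \<Longrightarrow> f x \<in> S"
  shows "commutator_product G y f xs \<in> lower_central (G\<lparr>carrier := S\<rparr>) 2"
  using assms(2,3)
proof (induction xs)
  case Nil
  show ?case
    using subgroup.one_closed[OF normal_imp_subgroup[OF
        group.lower_central_normal[OF subgroup_imp_group[OF S], of 2]]]
    by simp
next
  case (Cons x xs)
  let ?S = "G\<lparr>carrier := S\<rparr>"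
  have "commutator ?S (y x) (f x) \<in> lower_central ?S (Suc 1)"
    using Cons.prems by (intro group.commutator_in_lower_central subgroup_imp_group S) simp_all
  then have "commutator G (y x) (f x) \<in> lower_central ?S 2"
    using Cons.prems by (simp add: commutator_consistent[OF is_group S] numeral_2_eq_2)
  moreover have "commutator_product G y f xs \<in> lower_central ?S 2"
    using Cons by simp
  ultimately show ?case
    using subgroup.m_closed[OF normal_imp_subgroup[OF
        group.lower_central_normal[OF subgroup_imp_group[OF S], of 2]]]
    by simp
qed

text \<open>The hypothesis says \<open>S = \<gamma>\<^sub>2(S) c(G)\<close>.  It yields surjectivity on every quotient by
  \<open>lower_central_set_mult_eq_carrier\<close>; injectivity comes from the \<open>i\<close>-th projection of the completion,
  which sends \<open>\<gamma>\<^sub>i(S)\<close> to \<open>\<one>\<close> and recovers the coset of \<open>x\<close> from \<open>c x\<close>.\<close>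

lemma (in group) parafree_subgroupI:
  assumes S: "subgroup S (pronilpotent_completion G)"
    and cS: "completion_map G ` carrier G \<subseteq> S"
    and decomp: "\<And>s. s \<in> S \<Longrightarrow>
      \<exists>u\<in>lower_central ((pronilpotent_completion G)\<lparr>carrier := S\<rparr>) 2. \<exists>f\<in>carrier G.
        s = u \<otimes>\<^bsub>pronilpotent_completion G\<^esub> completion_map G f"
  shows "parafree_subgroup G S"
proof -
  let ?P = "pronilpotent_completion G" and ?c = "completion_map G"
  let ?S = "?P\<lparr>carrier := S\<rparr>"
  interpret S: group ?S by (rule group.subgroup_imp_group[OF completion_group S])
  have c_hom: "group_hom G ?S ?c"
    unfolding group_hom_def group_hom_axioms_def
  proof (intro conjI is_group S.is_group homI)
    show "?c x \<in> carrier ?S" if "x \<in> carrier G" for x using cS that by auto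
    show "?c (x \<otimes> y) = ?c x \<otimes>\<^bsub>?S\<^esub> ?c y" if "x \<in> carrier G" "y \<in> carrier G" for x y
      using group_hom.hom_mult[OF completion_map_hom that] by simp
  qed
  interpret c: group_hom G ?S ?c by (rule c_hom)
  have A: "subgroup (?c ` carrier G) ?S" by (rule c.img_is_subgroup)
  have "lower_central ?S 2 <#>\<^bsub>?S\<^esub> ?c ` carrier G = carrier ?S"
  proof
    show "lower_central ?S 2 <#>\<^bsub>?S\<^esub> ?c ` carrier G \<subseteq> carrier ?S"
      by (intro S.setmult_subset_G subgroup.subset[OF A]
          subgroup.subset[OF normal_imp_subgroup[OF S.lower_central_normal]])
    show "carrier ?S \<subseteq> lower_central ?S 2 <#>\<^bsub>?S\<^esub> ?c ` carrier G"
    proof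
      fix s assume "s \<in> carrier ?S"
      then obtain u f where "u \<in> lower_central ?S 2" "f \<in> carrier G" "s = u \<otimes>\<^bsub>?S\<^esub> ?c f"
        using decomp[of s] by auto
      then show "s \<in> lower_central ?S 2 <#>\<^bsub>?S\<^esub> ?c ` carrier G"
        unfolding set_mult_def by blast
    qed
  qed
  note gen = S.lower_central_set_mult_eq_carrier[OF A this]
  have "quotient_map ?S (lower_central ?S i) ?c \<in> iso (G Mod lower_central G i) (?S Mod lower_central ?S i)"
    if i: "i \<ge> 1" for i
  proof -
    let ?N = "lower_central G i" and ?M = "lower_central ?S i"
    let ?q = "quotient_map ?S ?M ?c"
    interpret N: normal ?N G by (rule lower_central_normal)
    interpret M: normal ?M ?S by (rule S.lower_central_normal)
    have "?c ` ?N \<subseteq> (\<lambda>x. x) ` ?M"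
    proof (rule image_lower_central_subset[OF c_hom])
      show "group_hom ?S ?S (\<lambda>x. x)"
        by (simp add: group_hom_def group_hom_axioms_def S.is_group hom_def)
      show "?c ` carrier G \<subseteq> (\<lambda>x. x) ` carrier ?S" using cS by simp
    qed
    then have q: "?q (?N #> x) = ?M #>\<^bsub>?S\<^esub> ?c x" if "x \<in> carrier G" for x
      using that by (intro quotient_map_coset N.normal_axioms M.normal_axioms c.homh) simp_all
    have q_closed: "?M #>\<^bsub>?S\<^esub> ?c x \<in> carrier (?S Mod ?M)" if "x \<in> carrier G" for x
      unfolding carrier_FactGroup using that by (intro imageI c.hom_closed)
    have inj: "?N #> x = ?N #> y"
      if xy: "x \<in> carrier G" "y \<in> carrier G" and eq: "?M #>\<^bsub>?S\<^esub> ?c x = ?M #>\<^bsub>?S\<^esub> ?c y" for x y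
    proof -
      let ?z = "x \<otimes> inv y"
      have z: "?z \<in> carrier G" using xy by simp
      have "?c x \<otimes>\<^bsub>?S\<^esub> inv\<^bsub>?S\<^esub> ?c y \<in> ?M"
        using eq by (simp only: M.coset_eq_iff[OF c.hom_closed[OF xy(1)] c.hom_closed[OF xy(2)]])
      moreover have "?c ?z = ?c x \<otimes>\<^bsub>?S\<^esub> inv\<^bsub>?S\<^esub> ?c y"
        using xy by (simp only: c.hom_mult c.hom_inv inv_closed)
      ultimately have z_M: "?c ?z \<in> ?M" by simp
      have "(\<lambda>s. s i) ` ?M \<subseteq> (\<lambda>x. ?N #> x) ` ?N"
      proof (rule image_lower_central_subset[OF _ lower_central_coset_hom])
        interpret p: group_hom ?P "G Mod ?N" "\<lambda>s. s i" by (rule completion_projection_hom[OF i])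
        have SP: "s \<in> carrier ?P" if "s \<in> S" for s by (rule subgroup.mem_carrier[OF S that])
        show "group_hom ?S (G Mod ?N) (\<lambda>s. s i)"
          unfolding group_hom_def group_hom_axioms_def
        proof (intro conjI S.is_group N.factorgroup_is_group homI)
          show "s i \<in> carrier (G Mod ?N)" if "s \<in> carrier ?S" for s
            using SP that by (intro p.hom_closed) simp
          show "(s \<otimes>\<^bsub>?S\<^esub> t) i = s i \<otimes>\<^bsub>G Mod ?N\<^esub> t i" if "s \<in> carrier ?S" "t \<in> carrier ?S" for s t
            using p.hom_mult[OF SP SP] that by simp
        qed
        show "(\<lambda>s. s i) ` carrier ?S \<subseteq> (\<lambda>x. ?N #> x) ` carrier G"
          unfolding carrier_FactGroup[symmetric] using SP by (intro image_subsetI p.hom_closed) simp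
      qed
      from subsetD[OF this imageI[OF z_M]]
      obtain u where u: "u \<in> ?N" "?c ?z i = ?N #> u" by auto
      have "?N #> ?z = ?N #> u" using u i by (simp add: completion_map_eq coset_sequence_apply)
      also have "\<dots> = ?N" using u by (simp add: N.coset_eq_self_iff)
      finally have "?z \<in> ?N" using N.coset_eq_self_iff[OF z] by simp
      then show ?thesis using N.coset_eq_iff[OF xy] by simp
    qed
    have "?q \<in> hom (G Mod ?N) (?S Mod ?M)"
    proof (rule homI)
      fix X assume "X \<in> carrier (G Mod ?N)"
      then obtain x where x: "x \<in> carrier G" "X = ?N #> x" unfolding carrier_FactGroup by (rule imageE)
      show "?q X \<in> carrier (?S Mod ?M)" using x q q_closed by simp
      fix Y assume "Y \<in> carrier (G Mod ?N)"
      then obtain y where y: "y \<in> carrier G" "Y = ?N #> y" unfolding carrier_FactGroup by (rule imageE)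
      have "?q (X \<otimes>\<^bsub>G Mod ?N\<^esub> Y) = ?q (?N #> (x \<otimes> y))"
        using x y by (simp add: N.rcos_sum)
      also have "\<dots> = ?M #>\<^bsub>?S\<^esub> (?c x \<otimes>\<^bsub>?S\<^esub> ?c y)"
        using x y by (simp only: q m_closed c.hom_mult)
      also have "\<dots> = ?q X \<otimes>\<^bsub>?S Mod ?M\<^esub> ?q Y"
        using x y by (simp only: q mult_FactGroup M.rcos_sum c.hom_closed)
      finally show "?q (X \<otimes>\<^bsub>G Mod ?N\<^esub> Y) = ?q X \<otimes>\<^bsub>?S Mod ?M\<^esub> ?q Y" .
    qed
    moreover have "bij_betw ?q (carrier (G Mod ?N)) (carrier (?S Mod ?M))"
    proof (rule bij_betw_imageI)
      show "inj_on ?q (carrier (G Mod ?N))"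
        unfolding carrier_FactGroup
      proof (rule inj_onI, elim imageE)
        fix X Y x y assume "x \<in> carrier G" "y \<in> carrier G" "X = ?N #> x" "Y = ?N #> y" "?q X = ?q Y"
        then show "X = Y" using inj[of x y] q by simp
      qed
      show "?q ` carrier (G Mod ?N) = carrier (?S Mod ?M)"
      proof
        show "?q ` carrier (G Mod ?N) \<subseteq> carrier (?S Mod ?M)"
          unfolding carrier_FactGroup[of G]
        proof (intro image_subsetI, elim imageE)
          fix X x assume "x \<in> carrier G" "X = ?N #> x"
          then show "?q X \<in> carrier (?S Mod ?M)" using q q_closed by simp
        qed
        show "carrier (?S Mod ?M) \<subseteq> ?q ` carrier (G Mod ?N)"
        proof
          fix X assume "X \<in> carrier (?S Mod ?M)"
          then obtain s where s: "s \<in> carrier ?S" "X = ?M #>\<^bsub>?S\<^esub> s"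
            unfolding carrier_FactGroup by (rule imageE)
          have "s \<in> ?M <#>\<^bsub>?S\<^esub> ?c ` carrier G" unfolding gen[OF i] by (rule s)
          then obtain u f where u: "u \<in> ?M" and f: "f \<in> carrier G" and s_eq: "s = u \<otimes>\<^bsub>?S\<^esub> ?c f"
            unfolding set_mult_def by blast
          have "?M #>\<^bsub>?S\<^esub> s = ?M #>\<^bsub>?S\<^esub> ?c f"
          proof -
            have cf: "?c f \<in> carrier ?S" by (rule c.hom_closed[OF f])
            have "s \<otimes>\<^bsub>?S\<^esub> inv\<^bsub>?S\<^esub> ?c f = u"
              unfolding s_eq using M.mem_carrier[OF u] cf
              by (simp only: S.m_assoc S.inv_closed S.r_inv S.r_one)
            then show ?thesis unfolding M.coset_eq_iff[OF s(1) cf] using u by (simp only:)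
          qed
          then have "X = ?q (?N #> f)" using s q[OF f] by simp
          moreover have "?N #> f \<in> carrier (G Mod ?N)"
            unfolding carrier_FactGroup using f by (rule imageI)
          ultimately show "X \<in> ?q ` carrier (G Mod ?N)" by (rule image_eqI)
        qed
      qed
    qed
    ultimately show ?thesis unfolding iso_def by simp
  qed
  then show ?thesis
    unfolding parafree_subgroup_def Let_def using S cS by simp
qed

section \<open>Closing off\<close>

text \<open>A countable form of the downward Loewenheim-Skolem argument: \<open>W s\<close> are witnesses that the subgroup
  must contain along with \<open>s\<close>, and countably many rounds of adding quotients and witnesses suffice.\<close>

lemma (in group) countable_closed_subgroup:
  assumes C: "countable C" "C \<subseteq> carrier G"
    and W: "\<And>s. s \<in> carrier G \<Longrightarrow> countable (W s)" "\<And>s. s \<in> carrier G \<Longrightarrow> W s \<subseteq> carrier G"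
  obtains S where "subgroup S G" "countable S" "C \<subseteq> S" "\<forall>s\<in>S. W s \<subseteq> S"
proof -
  define step where "step U = U \<union> (\<lambda>(a, b). a \<otimes> inv b) ` (U \<times> U) \<union> (\<Union>s\<in>U. W s)" for U
  define U where "U n = (step ^^ n) (insert \<one> C)" for n
  define S where "S = (\<Union>n. U n)"
  have U0: "U 0 = insert \<one> C" and U_Suc: "U (Suc n) = step (U n)" for n
    by (simp_all add: U_def)
  have U: "countable (U n) \<and> U n \<subseteq> carrier G" for n
  proof (induction n)
    case 0
    then show ?case using C by (simp add: U0)
  next
    case (Suc n)
    then have UG: "s \<in> carrier G" if "s \<in> U n" for s using that by auto
    have "countable (\<Union>s\<in>U n. W s)"
      using Suc W(1)[OF UG] by (intro countable_UN) simp_all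
    moreover have "(\<Union>s\<in>U n. W s) \<subseteq> carrier G" using W(2)[OF UG] by (rule UN_least)
    moreover have "(\<lambda>(a, b). a \<otimes> inv b) ` (U n \<times> U n) \<subseteq> carrier G"
      using Suc by (auto dest: subsetD)
    ultimately show ?case using Suc by (simp add: U_Suc step_def)
  qed
  have "U n \<subseteq> U (Suc n)" for n by (auto simp: U_Suc step_def)
  then have mono: "U m \<subseteq> U n" if "m \<le> n" for m n using lift_Suc_mono_le[of U] that by blast
  have diff: "a \<otimes> inv b \<in> S" if "a \<in> S" "b \<in> S" for a b
  proof -
    from that obtain m n where "a \<in> U m" "b \<in> U n" unfolding S_def by blast
    then have "a \<in> U (max m n)" "b \<in> U (max m n)"
      using mono[of m "max m n"] mono[of n "max m n"] by auto
    then have "a \<otimes> inv b \<in> U (Suc (max m n))" by (auto simp: U_Suc step_def)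
    then show ?thesis by (auto simp: S_def)
  qed
  have one: "\<one> \<in> S" using U0 by (auto simp: S_def)
  have SG: "s \<in> carrier G" if "s \<in> S" for s using that U by (auto simp: S_def)
  have inv: "inv b \<in> S" if "b \<in> S" for b using diff[OF one that] SG[OF that] by simp
  show ?thesis
  proof (rule that)
    show "subgroup S G"
    proof (rule subgroupI)
      show "S \<subseteq> carrier G" using SG by (rule subsetI)
      show "S \<noteq> {}" using one by auto
      show "inv a \<in> S" if "a \<in> S" for a using that by (rule inv)
      show "a \<otimes> b \<in> S" if "a \<in> S" "b \<in> S" for a b
        using diff[OF that(1) inv[OF that(2)]] SG[OF that(2)] by simp
    qed
    show "countable S" unfolding S_def using U by (intro countable_UN) simp_all
    show "C \<subseteq> S" using U0 by (auto simp: S_def)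
    show "\<forall>s\<in>S. W s \<subseteq> S"
    proof
      fix s assume "s \<in> S"
      then obtain n where "s \<in> U n" unfolding S_def by blast
      then have "W s \<subseteq> U (Suc n)" by (auto simp: U_Suc step_def)
      then show "W s \<subseteq> S" by (auto simp: S_def)
    qed
  qed
qed

text \<open>A countable subgroup that contains the generators is the whole group.\<close>

lemma (in group) countable_if_finitely_generated:
  assumes "finite X" "X \<subseteq> carrier G" "generate G X = carrier G"
  shows "countable (carrier G)"
proof -
  obtain S where S: "subgroup S G" "countable S" "X \<subseteq> S"
    by (rule countable_closed_subgroup[OF countable_finite[OF assms(1)] assms(2), of "\<lambda>_. {}"])
      simp_all
  have "carrier G \<subseteq> S" using generate_subgroup_incl[OF S(3,1)] assms(3) by simp
  then show ?thesis by (rule countable_subset[OF _ S(2)])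
qed

text \<open>The witnesses of \<open>s\<close> are the elements \<open>y x\<close> of one chosen decomposition of \<open>s\<close> from
  \<open>completion_commutator_product\<close>.  Once they belong to \<open>S\<close>, the commutators in that decomposition
  are commutators of \<open>S\<close> itself and not merely of the completion.\<close>

lemma (in group) countable_parafree_subgroup_containing:
  assumes X: "finite X" "X \<subseteq> carrier G" "generate G X = carrier G"
    and C: "countable C" "C \<subseteq> carrier (pronilpotent_completion G)"
  obtains S where "S \<in> countable_parafree_subgroups G" "C \<subseteq> S"
proof -
  let ?P = "pronilpotent_completion G" and ?c = "completion_map G"
  interpret c: group_hom G ?P ?c by (rule completion_map_hom)
  obtain xs where xs: "set xs = X" "distinct xs" using finite_distinct_list[OF X(1)] by blast
  let ?D = "\<lambda>s y f. (\<forall>x. y x \<in> carrier ?P) \<and> f \<in> carrier G \<and>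
    s = commutator_product ?P y ?c xs \<otimes>\<^bsub>?P\<^esub> ?c f"
  have "\<exists>y f. ?D s y f" if s: "s \<in> carrier ?P" for s
  proof -
    have "set xs \<subseteq> carrier G" "generate G (set xs) = carrier G" using X xs(1) by simp_all
    then obtain y f where "\<forall>x. y x \<in> carrier ?P" "f \<in> carrier G"
      "s = commutator_product ?P y ?c xs \<otimes>\<^bsub>?P\<^esub> ?c f"
      by (rule completion_commutator_product[OF xs(2) _ _ s])
    then have "?D s y f" by simp
    then show ?thesis by (intro exI)
  qed
  then obtain y f where D: "\<And>s. s \<in> carrier ?P \<Longrightarrow> ?D s (y s) (f s)" by metis
  have "countable (C \<union> ?c ` carrier G)"
    using C(1) countable_if_finitely_generated[OF X] by simp
  moreover have "C \<union> ?c ` carrier G \<subseteq> carrier ?P"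
    using C(2) c.hom_closed by (intro Un_least image_subsetI)
  ultimately obtain S where S: "subgroup S ?P" "countable S" "C \<union> ?c ` carrier G \<subseteq> S"
    and closed: "\<forall>s\<in>S. y s ` X \<subseteq> S"
  proof (rule group.countable_closed_subgroup[OF completion_group])
    show "countable (y s ` X)" for s using X(1) by (simp add: countable_finite)
    show "y s ` X \<subseteq> carrier ?P" if "s \<in> carrier ?P" for s
      using D[OF that] by (intro image_subsetI) simp
  qed
  have "parafree_subgroup G S"
  proof (rule parafree_subgroupI[OF S(1)])
    show "?c ` carrier G \<subseteq> S" using S(3) by simp
    fix s assume s: "s \<in> S"
    note Ds = D[OF subgroup.mem_carrier[OF S(1) s]]
    have "commutator_product ?P (y s) ?c xs \<in> lower_central (?P\<lparr>carrier := S\<rparr>) 2"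
    proof (rule group.commutator_product_in_lower_central_2[OF completion_group S(1)])
      fix x assume "x \<in> set xs"
      then have "x \<in> X" using xs(1) by simp
      then show "y s x \<in> S" using bspec[OF closed s] by blast
      show "?c x \<in> S" using \<open>x \<in> X\<close> X(2) S(3) by blast
    qed
    then show "\<exists>u\<in>lower_central (?P\<lparr>carrier := S\<rparr>) 2. \<exists>f\<in>carrier G. s = u \<otimes>\<^bsub>?P\<^esub> ?c f"
      using Ds by blast
  qed
  then show ?thesis
    using S by (intro that[of S]) (simp_all add: countable_parafree_subgroups_def)
qed

section \<open>Finitely generated free groups\<close>

lemma free_group_generators:
  "generate (free_group B) ((\<lambda>x. [(x, True)]) ` B) = carrier (free_group B)"
proof
  interpret F: group "free_group B" by (rule group_free_group)
  let ?X = "(\<lambda>x. [(x, True)]) ` B"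
  have X: "?X \<subseteq> carrier (free_group B)" by (auto simp: free_group_simps)
  show "generate (free_group B) ?X \<subseteq> carrier (free_group B)" by (rule F.generate_incl[OF X])
  have letter: "[l] \<in> generate (free_group B) ?X" if l: "fst l \<in> B" for l
  proof (cases "snd l")
    case True
    then have "[l] = [(fst l, True)]" by (simp add: prod_eq_iff)
    then show ?thesis using l by (auto intro: generate.incl)
  next
    case False
    have "[l] \<otimes>\<^bsub>free_group B\<^esub> [(fst l, True)] = \<one>\<^bsub>free_group B\<^esub>"
      using False by (simp add: free_group_simps inv_letter_def prod_eq_iff)
    then have "inv\<^bsub>free_group B\<^esub> [(fst l, True)] = [l]"
      using l by (intro F.inv_equality) (auto simp: free_group_simps)
    moreover have "inv\<^bsub>free_group B\<^esub> [(fst l, True)] \<in> generate (free_group B) ?X"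
      using l by (intro generate.inv) auto
    ultimately show ?thesis by simp
  qed
  show "carrier (free_group B) \<subseteq> generate (free_group B) ?X"
  proof
    fix w assume "w \<in> carrier (free_group B)"
    then show "w \<in> generate (free_group B) ?X"
    proof (induction w)
      case Nil
      show ?case using generate.one[of "free_group B" ?X] by (simp add: free_group_simps)
    next
      case (Cons l w)
      have "w \<in> carrier (free_group B)" "fst l \<in> B"
        using Cons.prems by (auto simp: free_group_simps dest: reduced_tl)
      moreover have "l # w = [l] \<otimes>\<^bsub>free_group B\<^esub> w"
        using Cons.prems by (simp add: free_group_simps push_reduced)
      ultimately show ?case using generate.eng[OF letter Cons.IH] by simp
    qed
  qed
qed

lemma (in group) free_finitely_generated:
  assumes B: "finite B" and iso: "G \<cong> free_group B"
  obtains X where "finite X" "X \<subseteq> carrier G" "generate G X = carrier G"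
proof -
  let ?X = "(\<lambda>x. [(x, True)]) ` B"
  obtain h where h: "h \<in> iso (free_group B) G" using iso_sym[OF iso] by (auto simp: is_iso_def)
  interpret h: group_hom "free_group B" G h
    using h group_free_group is_group by (simp add: group_hom_def group_hom_axioms_def iso_def)
  have X: "?X \<subseteq> carrier (free_group B)" by (auto simp: free_group_simps)
  have "h ` carrier (free_group B) = carrier G" using h by (simp add: iso_def bij_betw_def)
  then have "generate G (h ` ?X) = carrier G"
    by (simp only: h.generate_img[OF X] free_group_generators)
  moreover have "h ` ?X \<subseteq> carrier G" using X by (intro image_subsetI h.hom_closed) (rule subsetD)
  ultimately show ?thesis using B by (intro that[of "h ` ?X"]) simp_all
qed

theorem proposition1:
  fixes F :: "('a, 'm) monoid_scheme" and B :: "'x set"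
  assumes "group F" and "finite B" and "card B \<ge> 2" and "F \<cong> free_group B"
  shows "countable_parafree_subgroups F \<noteq> {} \<and>
         (\<forall>G1\<in>countable_parafree_subgroups F. \<forall>G2\<in>countable_parafree_subgroups F.
            \<exists>G3\<in>countable_parafree_subgroups F. G1 \<subseteq> G3 \<and> G2 \<subseteq> G3) \<and>
         \<Union>(countable_parafree_subgroups F) = carrier (pronilpotent_completion F)"
proof -
  interpret F: group F by fact
  let ?P = "pronilpotent_completion F" and ?K = "countable_parafree_subgroups F"
  obtain X where X: "finite X" "X \<subseteq> carrier F" "generate F X = carrier F"
    using assms(2,4) by (rule F.free_finitely_generated)
  have K: "S \<subseteq> carrier ?P" "countable S" if "S \<in> ?K" for S
    using that subgroup.subset[of S ?P]
    by (simp_all add: countable_parafree_subgroups_def parafree_subgroup_def)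
  have ex: "\<exists>S\<in>?K. C \<subseteq> S" if "countable C" "C \<subseteq> carrier ?P" for C
    using F.countable_parafree_subgroup_containing[OF X that] by blast
  have "?K \<noteq> {}" using ex[of "{}"] by auto
  moreover have "\<exists>G3\<in>?K. G1 \<subseteq> G3 \<and> G2 \<subseteq> G3" if "G1 \<in> ?K" "G2 \<in> ?K" for G1 G2
    using ex[of "G1 \<union> G2"] K[OF that(1)] K[OF that(2)] by auto
  moreover have "\<Union>?K = carrier ?P"
  proof
    show "\<Union>?K \<subseteq> carrier ?P" using K(1) by (rule Union_least)
    show "carrier ?P \<subseteq> \<Union>?K"
    proof
      fix s assume "s \<in> carrier ?P"
      then show "s \<in> \<Union>?K" using ex[of "{s}"] by auto
    qed
  qed
  ultimately show ?thesis by blast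
qed

end
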